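(* Consider the Cartesian stochastic variational inequality setting described in the context, and assume in addition that $X$ is bounded. Let $D\triangleq\max_{x\in X}\|x-x_0\|$, let $c$ be a scalar with $c\in(0,\frac{\eta}{2})$, and for each $i=1,\dots,N$ let $r_i\in[1,1+\frac{\eta-2c}{L}]$. Assume $\nu\ge \frac{DL}{\sqrt 2}$. Let the stepsizes in the distributed scheme be given, for each $i=1,\dots,N$, by $$\gamma_{0,i}=r_i c\,\frac{D^2}{\left(1+\frac{\eta-2c}{L}\right)^2\nu^2},\qquad \gamma_{k,i}=\gamma_{k-1,i}\left(1-\frac{c}{r_i}\gamma_{k-1,i}\right)\quad\text{for all }k\ge1.$$ Put $\beta=\frac{\eta-2c}{L}$, $e_0=D^2$, and define $$\delta_0^*=\frac{\eta-\beta L}{2(1+\beta)^2\nu^2}e_0,\quad \delta_k^*=\delta_{k-1}^*\Big(1-\frac{\eta-\beta L}{2}\delta_{k-1}^*\Big),\qquad \Gamma_0^*=\frac{\eta-\beta L}{2(1+\beta)\nu^2}e_0,\quad \Gamma_k^*=\Gamma_{k-1}^*\Big(1-\frac{\eta-\beta L}{2(1+\beta)}\Gamma_{k-1}^*\Big)\ (k\ge1).$$ Then: (a) for all $i,j\in\{1,\dots,N\}$ and $k\ge0$, $\gamma_{k,i}/r_i=\gamma_{k,j}/r_j$; (b) for all $k\ge0$, $\delta_k^*\le\min_{1\le i\le N}\gamma_{k,i}$, $\Gamma_k^*\ge\max_{1\le i\le N}\gamma_{k,i}$, and $\frac{\Gamma_k^*-\delta_k^*}{\delta_k^*}\le\beta$,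 where $0\le\beta<\frac{\eta}{L}$; (c) the sequence $\{x_k\}$ generated by the scheme converges almost surely to the unique solution $x^*$ of VI$(X,F)$; (d) with the error functions $e_k$ defined by $e_0=D^2$ and $e_{k+1}(\delta_0,\dots,\delta_k)=(1-(\eta-\beta L)\delta_k)e_k(\delta_0,\dots,\delta_{k-1})+(1+\beta)^2\nu^2\delta_k^2$, one has $e_k(\delta_0^*,\dots,\delta_{k-1}^* )=\frac{2(1+\beta)^2\nu^2}{\eta-\beta L}\delta_k^*$ for all $k\ge0$, and for every $k\ge1$ and every $(\delta_0,\dots,\delta_{k-1})\in\mathbb G_k\triangleq\{\alpha\in\mathbb R^k: 0<\alpha_j\le\frac{\eta-\beta L}{(1+\beta)^2L^2}\ \forall j\}$, the vector $(\delta_0^*,\dots,\delta_{k-1}^* )$ lies in $\mathbb G_k$ and $e_k(\delta_0,\dots,\delta_{k-1})-e_k(\delta_0^*,\dots,\delta_{k-1}^* )\ge(1+\beta)^2\nu^2(\delta_{k-1}-\delta_{k-1}^* )^2$; in particular $(\delta_0^*,\dots,\delta_{k-1}^* )$ minimizes $e_k$ over $\mathbb G_k$.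
   Context: Let $N\ge1$, $n_1,\dots,n_N\ge1$, $n=\sum_i n_i$, and $X=\prod_{i=1}^N X_i$ where each $X_i\subseteq\mathbb R^{n_i}$ is nonempty, closed and convex. For random vectors $\xi_i$ and functions $\Phi_i$, let $F_i(x)=\mathsf E[\Phi_i(x,\xi_i)]\in\mathbb R^{n_i}$ and $F=(F_1;\dots;F_N):X\to\mathbb R^n$. VI$(X,F)$ asks for $x^*\in X$ with $(x-x^* )^TF(x^* )\ge0$ for all $x\in X$. Assume $F$ is single-valued and Lipschitz continuous on $X$ with constant $L>0$, and strongly monotone on $X$ with constant $\eta>0$, i.e. $(F(x)-F(y))^T(x-y)\ge\eta\|x-y\|^2$ for all $x,y\in X$; then VI$(X,F)$ has a unique solution $x^*$. $\Pi_{X_i}$ is the Euclidean projection onto $X_i$. The distributed scheme is: $x_0\in X$ (random, independent of all other randomness, with $\mathsf E\|x_0\|^2<\infty$) and for $k\ge0$, $i=1,\dots,N$, $x_{k+1,i}=\Pi_{X_i}(x_{k,i}-\gamma_{k,i}(F_i(x_k)+w_{k,i}))$ with $w_{k,i}=\Phi_i(x_k,\xi_{k,i})-F_i(x_k)$, where $x_k=(x_{k,1};\dots;x_{k,N})$ and $\xi_k=(\xi_{k,1};\dots;\xi_{k,N})$ are samples. Let $\mathcal F_k=\{x_0,\xi_0,\dots,\xi_{k-1}\}$ ($\mathcal F_0=\{x_0\}$); the sampling is such that $\mathsf E[w_{k,i}\mid\mathcal F_k]=0$ for all $k,i$. Moreover there is a deterministic $\nu>0$ with $\mathsf E[\|w_k\|^2\mid\mathcal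 F_k]\le\nu^2$ a.s. for all $k\ge0$, where $w_k=(w_{k,1};\dots;w_{k,N})$.
   Formalization: The formal theorem additionally assumes that X has at least two points: if X is a single point then D=0 and δ*_0=0, so δ* is not in G_k and the ratio (Γ*_k−δ*_k)/δ*_k is undefined. *)

theory Defs
  imports "HOL-Analysis.Analysis" "HOL-Probability.Probability"
begin

text \<open>Cartesian structure: the coordinates 'n of R^n are partitioned into blocks
  indexed by the finite type 'b via blk.  Block i of a vector x, embedded in R^n
  (coordinates outside block i set to zero).\<close>
definition blockproj :: "('n \<Rightarrow> 'b) \<Rightarrow> 'b \<Rightarrow> real^'n \<Rightarrow> real^'n" where
  "blockproj blk i x = (\<chi> j. if blk j = i then x $ j else 0)"

definition blockspace :: "('n \<Rightarrow> 'b) \<Rightarrow> 'b \<Rightarrow> (real^'n) set" where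
  "blockspace blk i = {v. \<forall>j. blk j \<noteq> i \<longrightarrow> v $ j = 0}"

definition cartprod :: "('n \<Rightarrow> 'b) \<Rightarrow> ('b \<Rightarrow> (real^'n) set) \<Rightarrow> (real^'n) set" where
  "cartprod blk Xb = {x. \<forall>i. blockproj blk i x \<in> Xb i}"

definition is_VI_sol :: "(real^'n) set \<Rightarrow> (real^'n \<Rightarrow> real^'n) \<Rightarrow> real^'n \<Rightarrow> bool" where
  "is_VI_sol X F y \<longleftrightarrow> y \<in> X \<and> (\<forall>x\<in>X. (x - y) \<bullet> F y \<ge> 0)"

primrec rec_seq :: "real \<Rightarrow> real \<Rightarrow> nat \<Rightarrow> real" where
  "rec_seq a s0 0 = s0"
| "rec_seq a s0 (Suc k) = rec_seq a s0 k * (1 - a * rec_seq a s0 k)"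

primrec err_fun :: "real \<Rightarrow> real \<Rightarrow> real \<Rightarrow> (nat \<Rightarrow> real) \<Rightarrow> nat \<Rightarrow> real" where
  "err_fun a b e0 d 0 = e0"
| "err_fun a b e0 d (Suc k) = (1 - a * d k) * err_fun a b e0 d k + b * (d k)^2"

text \<open>The distributed stochastic projection scheme, for one realization:
  x0 initial point, gam k i the stepsize of block i at step k, Phi x s the sampled
  map, xi k the k-th sample, F the mapping.  w_k = Phi(x_k,xi_k) - F(x_k).\<close>
primrec dsa_iter :: "('n \<Rightarrow> 'b) \<Rightarrow> ('b \<Rightarrow> (real^'n) set) \<Rightarrow> (real^'n \<Rightarrow> real^'n)
    \<Rightarrow> (real^'n \<Rightarrow> 's \<Rightarrow> real^'n) \<Rightarrow> (nat \<Rightarrow> 's) \<Rightarrow> (nat \<Rightarrow> 'b \<Rightarrow> real) \<Rightarrow> real^'n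
    \<Rightarrow> nat \<Rightarrow> real^'n" where
  "dsa_iter blk Xb F Phi xi gam x0 0 = x0"
| "dsa_iter blk Xb F Phi xi gam x0 (Suc k) =
     (let x = dsa_iter blk Xb F Phi xi gam x0 k;
          w = Phi x (xi k) - F x
      in \<chi> j. closest_point (Xb (blk j))
                 (blockproj blk (blk j) x
                  - gam k (blk j) *\<^sub>R (blockproj blk (blk j) (F x) + blockproj blk (blk j) w)) $ j)"

definition nat_filtr :: "'w measure \<Rightarrow> 's measure \<Rightarrow> ('w \<Rightarrow> real^'n) \<Rightarrow> (nat \<Rightarrow> 'w \<Rightarrow> 's)
    \<Rightarrow> nat \<Rightarrow> 'w measure" where
  "nat_filtr M S x0 xi k = sigma (space M)
     ({x0 -` A \<inter> space M | A. A \<in> sets borel} \<union>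
      {xi j -` B \<inter> space M | j B. j < k \<and> B \<in> sets S})"

text \<open>D = max over x in X of norm (x - x0) (X compact, so the sup is a max).\<close>
definition diamD :: "(real^'n) set \<Rightarrow> real^'n \<Rightarrow> real" where
  "diamD X x0 = (SUP x\<in>X. norm (x - x0))"

definition stepsize :: "real \<Rightarrow> real \<Rightarrow> real \<Rightarrow> real \<Rightarrow> real \<Rightarrow> real \<Rightarrow> nat \<Rightarrow> real" where
  "stepsize L eta nu c r D k =
     rec_seq (c / r) (r * c * D^2 / ((1 + (eta - 2*c)/L)^2 * nu^2)) k"

definition scheme_iter :: "('n \<Rightarrow> 'b) \<Rightarrow> ('b \<Rightarrow> (real^'n) set) \<Rightarrow> (real^'n \<Rightarrow> real^'n)
    \<Rightarrow> (real^'n \<Rightarrow> 's \<Rightarrow> real^'n) \<Rightarrow> (nat \<Rightarrow> 'w \<Rightarrow> 's) \<Rightarrow> ('w \<Rightarrow> real^'n)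
    \<Rightarrow> real \<Rightarrow> real \<Rightarrow> real \<Rightarrow> real \<Rightarrow> ('b \<Rightarrow> real) \<Rightarrow> 'w \<Rightarrow> nat \<Rightarrow> real^'n" where
  "scheme_iter blk Xb F Phi xi x0 L eta nu c r \<omega> =
     dsa_iter blk Xb F Phi (\<lambda>k. xi k \<omega>)
       (\<lambda>k i. stepsize L eta nu c (r i) (diamD (cartprod blk Xb) (x0 \<omega>)) k) (x0 \<omega>)"

end

theory Submission
  imports Defs
begin

text \<open>All stepsizes are multiples \<open>\<gamma>\<^sub>k\<^sub>,\<^sub>i = r\<^sub>i G\<^sub>k\<close> of one sequence with \<open>G\<^sub>k\<^sub>+\<^sub>1 = G\<^sub>k (1 - c G\<^sub>k)\<close>, and
  \<open>\<delta>\<^sup>*\<^sub>k = G\<^sub>k\<close>, \<open>\<Gamma>\<^sup>*\<^sub>k = (1 + \<beta>) G\<^sub>k\<close>; optimality of \<open>\<delta>\<^sup>*\<close> is completion of the square, by induction on \<open>k\<close>.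

  For almost sure convergence, nonexpansiveness of the projection and strong monotonicity give
  \<open>u\<^sub>k\<^sub>+\<^sub>1 \<le> (1 - 2 c G\<^sub>k) u\<^sub>k + (1 + \<beta>)\<^sup>2 G\<^sub>k\<^sup>2 |w\<^sub>k|\<^sup>2\<close> plus a conditionally centred term, for the squared
  distance \<open>u\<^sub>k\<close> to the solution. Dividing by \<open>G\<^sub>k\<^sub>+\<^sub>1\<^sup>2 = G\<^sub>k\<^sup>2 (1 - c G\<^sub>k)\<^sup>2\<close> shows that
  \<open>E[u\<^sub>k / G\<^sub>k\<^sup>2]\<close> grows at most linearly; as \<open>c G\<^sub>k \<le> 1/(k+1)\<close>, this means \<open>E[u\<^sub>k] = O(1/k)\<close>. This is
  summable along \<open>k = m\<^sup>2\<close>, and the total movement between \<open>m\<^sup>2\<close> and \<open>(m+1)\<^sup>2\<close> has second moment \<open>O(1/m\<^sup>2)\<close>,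
  so both tend to \<open>0\<close> almost surely, without recourse to martingale convergence.\<close>

section \<open>Cartesian products of blocks\<close>

lemma blockproj_nth [simp]: "blockproj blk i x $ j = (if blk j = i then x $ j else 0)"
  by (simp add: blockproj_def)

lemma linear_blockproj: "linear (blockproj blk i)"
  by (rule linearI) (auto simp: vec_eq_iff)

lemma inner_eq_sum_blockproj:
  fixes x y :: "real^'n::finite" and blk :: "'n \<Rightarrow> 'b::finite"
  shows "x \<bullet> y = (\<Sum>i\<in>UNIV. blockproj blk i x \<bullet> blockproj blk i y)"
proof -
  have "(\<Sum>i\<in>UNIV. blockproj blk i x \<bullet> blockproj blk i y)
      = (\<Sum>i\<in>UNIV. \<Sum>j\<in>UNIV. if i = blk j then x $ j * y $ j else 0)"
    by (auto simp: inner_vec_def intro!: sum.cong)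
  also have "\<dots> = (\<Sum>j\<in>UNIV. \<Sum>i\<in>UNIV. if i = blk j then x $ j * y $ j else 0)"
    by (rule sum.swap)
  also have "\<dots> = x \<bullet> y"
    by (simp add: inner_vec_def)
  finally show ?thesis by simp
qed

lemma norm_eq_sum_blockproj:
  fixes x :: "real^'n::finite" and blk :: "'n \<Rightarrow> 'b::finite"
  shows "(norm x)\<^sup>2 = (\<Sum>i\<in>UNIV. (norm (blockproj blk i x))\<^sup>2)"
  unfolding power2_norm_eq_inner by (rule inner_eq_sum_blockproj)

lemma blockproj_assemble:
  assumes "p i \<in> blockspace blk i"
  shows "blockproj blk i (\<chi> j. p (blk j) $ j) = p i"
  using assms by (auto simp: vec_eq_iff blockspace_def)

lemma assemble_mem_cartprod:
  assumes "\<And>i. Xb i \<subseteq> blockspace blk i" "\<And>i. p i \<in> Xb i"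
  shows "(\<chi> j. p (blk j) $ j) \<in> cartprod blk Xb"
  unfolding cartprod_def using assms by (auto simp: blockproj_assemble subset_iff)

lemma cartprod_nonempty:
  assumes "\<And>i. Xb i \<subseteq> blockspace blk i" "\<And>i. Xb i \<noteq> {}"
  shows "cartprod blk Xb \<noteq> {}"
proof -
  have "(SOME x. x \<in> Xb i) \<in> Xb i" for i using assms(2) by (simp add: some_in_eq)
  then show ?thesis using assemble_mem_cartprod[OF assms(1)] by fast
qed

lemma cartprod_eq_INT: "cartprod blk Xb = (\<Inter>i. blockproj blk i -` Xb i)"
  by (auto simp: cartprod_def)

lemma closed_cartprod:
  fixes blk :: "'n::finite \<Rightarrow> 'b::finite"
  assumes "\<And>i. closed (Xb i)"
  shows "closed (cartprod blk Xb)"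
proof -
  have "continuous_on UNIV (blockproj blk i)" for i
    by (intro linear_continuous_on linear_conv_bounded_linear[THEN iffD1] linear_blockproj)
  then show ?thesis
    unfolding cartprod_eq_INT using assms by (intro closed_INT ballI closed_vimage)
qed

lemma convex_cartprod:
  fixes blk :: "'n::finite \<Rightarrow> 'b::finite"
  assumes "\<And>i. convex (Xb i)"
  shows "convex (cartprod blk Xb)"
  unfolding cartprod_eq_INT using assms
  by (auto intro!: convex_INT convex_linear_vimage linear_blockproj)

text \<open>The squared distance splits into a sum of squared block distances, and membership in the
  product constrains each block separately. Minimizing blockwise therefore minimizes globally, and
  uniqueness of the projection onto a closed convex set gives equality.\<close>

lemma closest_point_cartprod:
  fixes blk :: "'n::finite \<Rightarrow> 'b::finite"
  assumes sub: "\<And>i. Xb i \<subseteq> blockspace blk i" and ne: "\<And>i. Xb i \<noteq> {}"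
    and cl: "\<And>i. closed (Xb i)" and cv: "\<And>i. convex (Xb i)"
  shows "(\<chi> j. closest_point (Xb (blk j)) (blockproj blk (blk j) y) $ j)
    = closest_point (cartprod blk Xb) y" (is "?z = _")
proof (rule closest_point_unique[OF convex_cartprod[OF cv] closed_cartprod[OF cl]])
  define p where "p i = closest_point (Xb i) (blockproj blk i y)" for i
  have z: "?z = (\<chi> j. p (blk j) $ j)" by (simp add: p_def)
  have p: "p i \<in> Xb i" for i
    unfolding p_def by (rule closest_point_in_set[OF cl ne])
  show "?z \<in> cartprod blk Xb"
    unfolding z by (rule assemble_mem_cartprod[OF sub p])
  have pz: "blockproj blk i ?z = p i" for i
    unfolding z using p sub by (intro blockproj_assemble) auto
  show "\<forall>x\<in>cartprod blk Xb. dist y ?z \<le> dist y x"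
  proof
    fix x assume x: "x \<in> cartprod blk Xb"
    have "(norm (y - ?z))\<^sup>2 = (\<Sum>i\<in>UNIV. (norm (blockproj blk i y - p i))\<^sup>2)"
      by (subst norm_eq_sum_blockproj[of _ blk]) (simp only: linear_diff[OF linear_blockproj] pz)
    also have "\<dots> \<le> (\<Sum>i\<in>UNIV. (norm (blockproj blk i y - blockproj blk i x))\<^sup>2)"
    proof (intro sum_mono power_mono norm_ge_zero)
      fix i
      have "blockproj blk i x \<in> Xb i" using x by (simp add: cartprod_def)
      from closest_point_le[OF cl this, of "blockproj blk i y"]
      show "norm (blockproj blk i y - p i) \<le> norm (blockproj blk i y - blockproj blk i x)"
        by (simp add: p_def dist_norm)
    qed
    also have "\<dots> = (norm (y - x))\<^sup>2"
      by (subst norm_eq_sum_blockproj[of "y - x" blk]) (simp only: linear_diff[OF linear_blockproj])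
    finally show "dist y ?z \<le> dist y x"
      unfolding dist_norm by (rule power2_le_imp_le) simp
  qed
qed

text \<open>In \<open>F x + w\<close> the mean cancels, since \<open>w\<close> is the sample minus
  \<open>F x\<close>. The block updates thus form one projection onto the product, with a sample
  direction that is rescaled coordinatewise.\<close>

lemma dsa_iter_Suc_closest_point:
  fixes blk :: "'n::finite \<Rightarrow> 'b::finite"
  assumes "\<And>i. Xb i \<subseteq> blockspace blk i" "\<And>i. Xb i \<noteq> {}"
    and "\<And>i. closed (Xb i)" "\<And>i. convex (Xb i)"
  shows "dsa_iter blk Xb F Phi xi gam x0 (Suc k) =
    (let x = dsa_iter blk Xb F Phi xi gam x0 k in
     closest_point (cartprod blk Xb) (x - (\<chi> j. gam k (blk j) * Phi x (xi k) $ j)))"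
proof -
  have *: "blockproj blk i x - g i *\<^sub>R (blockproj blk i (F x) + blockproj blk i (y - F x))
     = blockproj blk i (x - (\<chi> j. g (blk j) * y $ j))" for i x y and g :: "'b \<Rightarrow> real"
    by (auto simp: vec_eq_iff)
  show ?thesis
    by (simp add: Let_def * closest_point_cartprod[OF assms])
qed

section \<open>Variational inequalities\<close>

text \<open>The Cartesian structure is what allows different weights in different blocks:
  the variational inequality can be tested with points that differ from the solution in a single block.\<close>
lemma VI_sol_blockwise_scaled:
  fixes blk :: "'n::finite \<Rightarrow> 'b::finite"
  assumes sol: "is_VI_sol (cartprod blk Xb) F y" and x: "x \<in> cartprod blk Xb"
    and r: "\<And>i. 0 \<le> r i"
  shows "0 \<le> (x - y) \<bullet> (\<chi> j. r (blk j) * F y $ j)"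
proof -
  have nn: "0 \<le> blockproj blk i (x - y) \<bullet> F y" for i
  proof -
    define z where "z = y + blockproj blk i (x - y)"
    have "blockproj blk l z = (if l = i then blockproj blk i x else blockproj blk l y)" for l
      by (auto simp: z_def vec_eq_iff)
    then have "z \<in> cartprod blk Xb"
      using sol x by (auto simp: cartprod_def is_VI_sol_def)
    then have "0 \<le> (z - y) \<bullet> F y" using sol by (simp add: is_VI_sol_def)
    then show ?thesis by (simp add: z_def)
  qed
  have "(x - y) \<bullet> (\<chi> j. r (blk j) * F y $ j)
    = (\<Sum>i\<in>UNIV. blockproj blk i (x - y) \<bullet> blockproj blk i (\<chi> j. r (blk j) * F y $ j))"
    by (rule inner_eq_sum_blockproj)
  also have "\<dots> = (\<Sum>i\<in>UNIV. r i * (blockproj blk i (x - y) \<bullet> F y))"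
    by (auto simp: inner_vec_def sum_distrib_left intro!: sum.cong)
  also have "\<dots> \<ge> 0" by (intro sum_nonneg mult_nonneg_nonneg r nn)
  finally show ?thesis .
qed

text \<open>In the expansion of \<open>(norm (v + (x - y)))\<^sup>2\<close> the cross term is
  nonnegative by assumption. For blockwise scaled \<open>v\<close> this makes the solution a fixed
  point of the projected step, although the blocks use different stepsizes.\<close>

lemma VI_sol_closest_point:
  assumes "closed X" "convex X" "y \<in> X" "\<And>x. x \<in> X \<Longrightarrow> 0 \<le> (x - y) \<bullet> v"
  shows "closest_point X (y - v) = y"
proof (rule closest_point_unique[OF assms(2,1,3), symmetric, rule_format])
  fix x assume x: "x \<in> X"
  have "(norm v)\<^sup>2 \<le> (norm (v + (x - y)))\<^sup>2"
    using assms(4)[OF x] by (simp add: power2_norm_eq_inner inner_add inner_commute)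
  then have "norm v \<le> norm (v + (x - y))" by (rule power2_le_imp_le) simp
  also have "norm (v + (x - y)) = norm (y - v - x)"
    by (simp add: norm_minus_commute algebra_simps)
  finally show "dist (y - v) y \<le> dist (y - v) x" by (simp add: dist_norm)
qed

text \<open>The projected step map is a contraction for a suitable steplength \<open>t\<close>:
  expanding the square gives the factor \<open>1 - 2 * t * eta + t\<^sup>2 * L\<^sup>2\<close>. Its
  Banach fixed point solves the inequality.\<close>

lemma VI_sol_exists:
  fixes F :: "real^'n \<Rightarrow> real^'n"
  assumes X: "closed X" "convex X" "X \<noteq> {}" and L: "L > 0" and eta: "eta > 0"
    and lip: "\<And>x y. x \<in> X \<Longrightarrow> y \<in> X \<Longrightarrow> norm (F x - F y) \<le> L * norm (x - y)"
    and mono: "\<And>x y. x \<in> X \<Longrightarrow> y \<in> X \<Longrightarrow> (F x - F y) \<bullet> (x - y) \<ge> eta * (norm (x - y))\<^sup>2"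
  shows "\<exists>y. is_VI_sol X F y"
proof -
  \<comment> \<open>With \<open>t = eta / L\<^sup>2\<close>, the minimizer of the factor above, the
    factor equals \<open>1 - eta\<^sup>2 / L\<^sup>2\<close>. The maximum with 0 covers
    \<open>eta > L\<close>, which is possible when \<open>X\<close> is a single point.\<close>
  define q where "q = sqrt (max 0 (1 - eta\<^sup>2 / L\<^sup>2))"
  define t where "t = eta / L\<^sup>2"
  have t: "t > 0" using L eta by (simp add: t_def)
  have q: "0 \<le> q" "q < 1" using L eta by (auto simp: q_def)
  have contr: "dist (closest_point X (x - t *\<^sub>R F x)) (closest_point X (y - t *\<^sub>R F y)) \<le> q * dist x y"
    if xy: "x \<in> X" "y \<in> X" for x y
  proof -
    have "dist (closest_point X (x - t *\<^sub>R F x)) (closest_point X (y - t *\<^sub>R F y))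
        \<le> norm ((x - y) - t *\<^sub>R (F x - F y))"
      using closest_point_lipschitz[OF X(2,1,3), of "x - t *\<^sub>R F x" "y - t *\<^sub>R F y"]
      by (simp add: dist_norm algebra_simps)
    also have "\<dots> \<le> q * norm (x - y)"
    proof (rule power2_le_imp_le)
      have "(norm ((x - y) - t *\<^sub>R (F x - F y)))\<^sup>2
        = (norm (x - y))\<^sup>2 - 2 * t * ((F x - F y) \<bullet> (x - y)) + t\<^sup>2 * (norm (F x - F y))\<^sup>2"
        unfolding power2_norm_eq_inner
        by (simp add: inner_diff inner_commute power2_eq_square algebra_simps)
      also have "\<dots> \<le> (norm (x - y))\<^sup>2 - 2 * t * (eta * (norm (x - y))\<^sup>2) + t\<^sup>2 * (L * norm (x - y))\<^sup>2"
        using t mono[OF xy] lip[OF xy]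
        by (intro add_mono diff_mono mult_left_mono power_mono) auto
      also have "\<dots> = (1 - eta\<^sup>2 / L\<^sup>2) * (norm (x - y))\<^sup>2"
        using L by (simp add: t_def field_simps power2_eq_square)
      also have "\<dots> \<le> q\<^sup>2 * (norm (x - y))\<^sup>2"
        by (intro mult_right_mono) (auto simp: q_def)
      finally show "(norm ((x - y) - t *\<^sub>R (F x - F y)))\<^sup>2 \<le> (q * norm (x - y))\<^sup>2"
        by (simp add: power_mult_distrib)
    qed (use q in simp)
    finally show ?thesis by (simp add: dist_norm)
  qed
  have "\<exists>!y\<in>X. closest_point X (y - t *\<^sub>R F y) = y"
    using X q contr
    by (intro Banach_fix[where c=q]) (auto simp: complete_eq_closed intro!: closest_point_in_set)
  then obtain y where y: "y \<in> X" "closest_point X (y - t *\<^sub>R F y) = y" by blast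
  \<comment> \<open>The displacement from a projection to its preimage makes a nonacute angle with
    every direction into \<open>X\<close>. At the fixed point this displacement is
    \<open>- t *\<^sub>R F y\<close>, and the positive factor \<open>t\<close> drops out.\<close>
  have "(x - y) \<bullet> F y \<ge> 0" if "x \<in> X" for x
    using closest_point_dot[OF X(2,1) that, of "y - t *\<^sub>R F y"] t y(2)
    by (simp add: inner_diff inner_commute zero_le_mult_iff algebra_simps)
  with y show ?thesis by (auto simp: is_VI_sol_def)
qed

text \<open>Testing each solution with the other and adding gives
  \<open>(F y - F z) \<bullet> (y - z) \<le> 0\<close>, which strong monotonicity allows only for
  \<open>y = z\<close>.\<close>

lemma VI_sol_unique:
  assumes eta: "eta > 0"
    and mono: "\<And>x y. x \<in> X \<Longrightarrow> y \<in> X \<Longrightarrow> (F x - F y) \<bullet> (x - y) \<ge> eta * (norm (x - y))\<^sup>2"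
    and y: "is_VI_sol X F y" and z: "is_VI_sol X F z"
  shows "y = z"
proof -
  have "0 \<le> (z - y) \<bullet> F y" "0 \<le> (y - z) \<bullet> F z" "y \<in> X" "z \<in> X"
    using y z by (auto simp: is_VI_sol_def)
  then have "eta * (norm (y - z))\<^sup>2 \<le> 0"
    using mono[of y z] by (simp add: inner_diff inner_commute algebra_simps)
  then show ?thesis using eta by (simp add: mult_le_0_iff)
qed

section \<open>One step with blockwise scaled stepsizes\<close>

lemma norm_scaled_le:
  fixes v :: "real^'n::finite"
  assumes "\<And>j. \<bar>s j\<bar> \<le> B"
  shows "norm (\<chi> j. s j * v $ j) \<le> B * norm v"
proof -
  have B: "0 \<le> B" using assms[of undefined] by linarith
  have "(norm (\<chi> j. s j * v $ j))\<^sup>2 = (\<Sum>j\<in>UNIV. (s j)\<^sup>2 * (v $ j)\<^sup>2)"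
    unfolding power2_norm_eq_inner
    by (simp add: inner_vec_def power2_eq_square algebra_simps)
  also have "\<dots> \<le> (\<Sum>j\<in>UNIV. B\<^sup>2 * (v $ j)\<^sup>2)"
    using assms B by (intro sum_mono mult_right_mono) (auto intro: abs_le_square_iff[THEN iffD1])
  also have "\<dots> = (B * norm v)\<^sup>2"
    unfolding power_mult_distrib power2_norm_eq_inner
    by (simp add: inner_vec_def power2_eq_square sum_distrib_left)
  finally show ?thesis by (rule power2_le_imp_le) (simp add: B)
qed

text \<open>Let \<open>R\<close> be the diagonal scaling by \<open>r\<close>. It differs from the
  identity by at most \<beta> in operator norm, so replacing \<open>v\<close> by \<open>R v\<close>
  in the monotonicity estimate costs only \<open>\<beta> * L\<close>. The drift then appears twice
  in the expanded square; by \<open>gb\<close> the quadratic term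
  \<open>g\<^sup>2 * (norm (R v))\<^sup>2\<close> consumes one copy, and one copy of
  \<open>eta - \<beta> * L\<close> remains.\<close>

lemma scaled_step_bound:
  fixes u v w :: "real^'n::finite"
  assumes vL: "norm v \<le> L * norm u" and mono: "v \<bullet> u \<ge> eta * (norm u)\<^sup>2"
    and r: "\<And>j. 1 \<le> r j" "\<And>j. r j \<le> 1 + \<beta>" and g: "0 \<le> g"
    and gb: "(1+\<beta>)\<^sup>2 * L\<^sup>2 * g \<le> eta - \<beta> * L"
  shows "(norm (u - g *\<^sub>R (\<chi> j. r j * (v + w) $ j)))\<^sup>2
    \<le> (1 - (eta - \<beta>*L) * g) * (norm u)\<^sup>2 + (1+\<beta>)\<^sup>2 * g\<^sup>2 * (norm w)\<^sup>2
      + g * ((\<chi> j. - 2 * r j * (u $ j - g * r j * v $ j)) \<bullet> w)"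
proof -
  define R where "R v = (\<chi> j. r j * v $ j)" for v :: "real^'n"
  have R: "norm (R v) \<le> (1 + \<beta>) * norm v" for v
    unfolding R_def using r by (intro norm_scaled_le) (metis abs_of_nonneg order_trans zero_le_one)
  have b: "0 \<le> \<beta>" using r[of undefined] by linarith
  have "norm ((\<chi> j. (r j - 1) * v $ j)) \<le> \<beta> * norm v"
    using r by (intro norm_scaled_le) (auto simp: abs_le_iff algebra_simps)
  moreover have "(\<chi> j. (r j - 1) * v $ j) = R v - v"
    by (auto simp: vec_eq_iff R_def algebra_simps)
  ultimately have "norm (R v - v) \<le> \<beta> * norm v" by simp
  then have "\<bar>u \<bullet> (R v - v)\<bar> \<le> norm u * (\<beta> * (L * norm u))"
    by (meson Cauchy_Schwarz_ineq2 b mult_left_mono norm_ge_zero order_trans vL)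
  then have uRv: "u \<bullet> R v \<ge> (eta - \<beta> * L) * (norm u)\<^sup>2"
    using mono by (simp add: inner_diff inner_commute power2_eq_square algebra_simps abs_le_iff)
  have "(norm (R v))\<^sup>2 \<le> ((1+\<beta>) * (L * norm u))\<^sup>2"
    using R[of v] vL b by (intro power_mono order_trans[OF R] mult_left_mono) auto
  then have "g\<^sup>2 * (norm (R v))\<^sup>2 \<le> g\<^sup>2 * ((1+\<beta>) * (L * norm u))\<^sup>2" by (intro mult_left_mono) auto
  also have "\<dots> = g * ((1+\<beta>)\<^sup>2 * L\<^sup>2 * g) * (norm u)\<^sup>2" by (simp add: power2_eq_square)
  also have "\<dots> \<le> g * (eta - \<beta> * L) * (norm u)\<^sup>2"
    using g gb by (intro mult_right_mono mult_left_mono) auto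
  finally have Rv: "g\<^sup>2 * (norm (R v))\<^sup>2 \<le> g * (eta - \<beta> * L) * (norm u)\<^sup>2" .
  have "(norm (R w))\<^sup>2 \<le> ((1+\<beta>) * norm w)\<^sup>2" using R by (intro power_mono) auto
  then have "g\<^sup>2 * (norm (R w))\<^sup>2 \<le> g\<^sup>2 * ((1+\<beta>) * norm w)\<^sup>2" by (intro mult_left_mono) auto
  then have Rw: "g\<^sup>2 * (norm (R w))\<^sup>2 \<le> (1+\<beta>)\<^sup>2 * g\<^sup>2 * (norm w)\<^sup>2"
    unfolding power_mult_distrib by (simp only: mult_ac)
  \<comment> \<open>These are the terms linear in \<open>w\<close>. They are kept exactly rather
    than estimated, because they are to vanish in conditional mean.\<close>
  have Y: "(\<chi> j. - 2 * r j * (u $ j - g * r j * v $ j)) \<bullet> w = - 2 * (u \<bullet> R w - g * (R v \<bullet> R w))"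
    by (simp add: R_def inner_vec_def sum_distrib_left sum_subtractf[symmetric] algebra_simps)
  have "u - g *\<^sub>R (\<chi> j. r j * (v + w) $ j) = u - g *\<^sub>R R v - g *\<^sub>R R w"
    by (auto simp: vec_eq_iff R_def algebra_simps)
  moreover have "(norm (u - g *\<^sub>R R v - g *\<^sub>R R w))\<^sup>2
    = (norm u)\<^sup>2 - 2 * (g * (u \<bullet> R v)) + g\<^sup>2 * (norm (R v))\<^sup>2 + g\<^sup>2 * (norm (R w))\<^sup>2
      + g * (- 2 * (u \<bullet> R w - g * (R v \<bullet> R w)))"
    unfolding power2_norm_eq_inner
    by (simp add: inner_diff inner_commute power2_eq_square algebra_simps)
  moreover have "g * ((eta - \<beta> * L) * (norm u)\<^sup>2) \<le> g * (u \<bullet> R v)"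
    by (intro mult_left_mono uRv g)
  ultimately show ?thesis using Rv Rw unfolding Y by (simp add: algebra_simps)
qed

section \<open>Stepsize recursion and error functions\<close>

text \<open>The factor \<open>1 - a * g\<close> is unchanged when \<open>g\<close> is multiplied and
  \<open>a\<close> divided by the same number, so the recursion is homogeneous. This links the
  stepsizes of different blocks to one another and to the upper envelope.\<close>

lemma rec_seq_scale: "s \<noteq> 0 \<Longrightarrow> rec_seq (a / s) (s * g0) k = s * rec_seq a g0 k"
  by (induction k) auto

lemma rec_seq_bounds:
  assumes "0 < c" "0 < g0" "c * g0 \<le> 1 / 2"
  shows "0 < rec_seq c g0 k \<and> rec_seq c g0 k \<le> g0"
proof (induction k)
  case (Suc k)
  let ?g = "rec_seq c g0 k"
  have "c * ?g \<le> c * g0" using Suc assms by (intro mult_left_mono) auto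
  then have "c * ?g \<le> 1/2" using assms by linarith
  moreover have "0 < c * ?g" using Suc assms by simp
  ultimately have "0 < ?g * (1 - c * ?g)" "?g * (1 - c * ?g) \<le> ?g * 1"
    using Suc by (auto intro!: mult_pos_pos mult_left_mono simp del: mult_1_right)
  with Suc show ?case by auto
qed (use assms in simp)

text \<open>For \<open>h = c * g\<close> the recursion is the logistic map with factor
  \<open>1 - h\<close>. If \<open>h * (k + 1) \<le> 1\<close>, then
  \<open>h * (1 - h) * (k + 2) \<le> (1 - h) * (1 + h) \<le> 1\<close>, which carries the
  induction.\<close>

lemma rec_seq_le_inverse:
  assumes "0 < c" "0 < g0" "c * g0 \<le> 1 / 2"
  shows "c * rec_seq c g0 k \<le> 1 / (real k + 1)"
proof (induction k)
  case (Suc k)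
  define h where "h = c * rec_seq c g0 k"
  have "h \<le> c * g0"
    unfolding h_def using rec_seq_bounds[OF assms, of k] assms(1) by (intro mult_left_mono) auto
  then have "h \<le> 1/2" using assms(3) by linarith
  moreover have "0 < h" using rec_seq_bounds[OF assms, of k] assms(1) by (simp add: h_def)
  ultimately have h: "0 < h" "h \<le> 1/2" by auto
  have hk: "h * (real k + 1) \<le> 1" using Suc by (simp add: h_def field_simps)
  have "h * (1 - h) * (real k + 2) = (1 - h) * (h * (real k + 1) + h)" by (simp add: algebra_simps)
  also have "\<dots> \<le> (1 - h) * (1 + h)" using h hk by (intro mult_left_mono) auto
  also have "\<dots> \<le> 1" by (simp add: algebra_simps)
  finally have "h * (1 - h) \<le> 1 / (real k + 2)" by (simp add: field_simps)
  then show ?case by (simp add: h_def algebra_simps)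
qed (use assms in simp)

text \<open>A crude geometric lower bound. It serves only to bound reciprocals of the stepsizes for
  each fixed \<open>k\<close>, where uniformity in \<open>k\<close> is irrelevant.\<close>

lemma rec_seq_ge:
  assumes "0 < c" "0 < g0" "c * g0 \<le> 1 / 2"
  shows "g0 / 2 ^ k \<le> rec_seq c g0 k"
proof (induction k)
  case (Suc k)
  let ?g = "rec_seq c g0 k"
  have "c * ?g \<le> c * g0" using rec_seq_bounds[OF assms, of k] assms by (intro mult_left_mono) auto
  then have "c * ?g \<le> 1/2" using assms by linarith
  then have "?g * (1/2) \<le> ?g * (1 - c * ?g)"
    using rec_seq_bounds[OF assms, of k] by (intro mult_left_mono) auto
  with Suc show ?case by simp
qed simp

text \<open>If \<open>e = 2 * b / a * d\<close>, one error step yields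
  \<open>2 * b / a * d - b * d\<^sup>2\<close>, that is, \<open>2 * b / a\<close> times
  \<open>d * (1 - a / 2 * d)\<close>. The stepsize recursion is exactly the one that preserves the
  proportionality.\<close>

lemma err_fun_rec_seq:
  assumes "a \<noteq> 0" "e0 = 2 * b / a * d0"
  shows "err_fun a b e0 (rec_seq (a / 2) d0) k = 2 * b / a * rec_seq (a / 2) d0 k"
proof (induction k)
  case (Suc k)
  show ?case unfolding err_fun.simps Suc using assms(1) by (simp add: field_simps power2_eq_square)
qed (use assms in simp)

lemma err_fun_minus_optimal:
  assumes a: "0 < a" and b: "0 \<le> b" and e0: "e0 = 2 * b / a * d0"
    and d: "\<And>j. j < k \<Longrightarrow> a * d j \<le> 1" and k: "k \<ge> 1"
  shows "err_fun a b e0 d k - err_fun a b e0 (rec_seq (a / 2) d0) k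
    \<ge> b * (d (k - 1) - rec_seq (a / 2) d0 (k - 1))\<^sup>2"
  using k d
proof (induction k rule: dec_induct)
  case base
  show ?case unfolding e0 using a by (simp add: field_simps power2_eq_square)
next
  case (step k)
  let ?s = "rec_seq (a / 2) d0"
  have "0 \<le> b * (d (k - 1) - ?s (k - 1))\<^sup>2" using b by simp
  also have "\<dots> \<le> err_fun a b e0 d k - err_fun a b e0 ?s k" using step by simp
  \<comment> \<open>The bound \<open>a * d k \<le> 1\<close> makes the factor nonnegative, so a lead
    gained in earlier steps is never reversed.\<close>
  finally have "(1 - a * d k) * err_fun a b e0 ?s k \<le> (1 - a * d k) * err_fun a b e0 d k"
    using step.prems[of k] by (intro mult_left_mono) auto
  \<comment> \<open>Since the optimal error is \<open>2 * b / a * ?s k\<close>, the left side is a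
    quadratic in \<open>d k\<close> with leading coefficient \<open>b\<close> and a double root at
    \<open>?s k\<close>.\<close>
  moreover have "(1 - a * d k) * err_fun a b e0 ?s k + b * (d k)\<^sup>2 - err_fun a b e0 ?s (Suc k)
     = b * (d k - ?s k)\<^sup>2"
    unfolding err_fun_rec_seq[OF a[THEN less_imp_neq[THEN not_sym]] e0]
    using a by (simp add: field_simps power2_eq_square)
  ultimately show ?case by simp
qed

section \<open>Mean-square rates and almost sure convergence\<close>

text \<open>Squares are sparse enough for the second moments along them to be summable, and close enough
  for the increments over one gap to be summable in mean square.\<close>
lemma (in prob_space) AE_tendsto_of_mean_square_rates:
  fixes x :: "nat \<Rightarrow> 'a \<Rightarrow> 'v::euclidean_space" and z :: 'v
  assumes meas [measurable]: "\<And>k. x k \<in> borel_measurable M"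
    and dist: "\<And>k. (\<integral>\<^sup>+\<omega>. ennreal ((norm (x k \<omega> - z))\<^sup>2) \<partial>M) \<le> ennreal (C / (real k + 1))"
    and incr: "\<And>k. (\<integral>\<^sup>+\<omega>. ennreal ((norm (x (Suc k) \<omega> - x k \<omega>))\<^sup>2) \<partial>M) \<le> ennreal (C / (real k + 1)\<^sup>2)"
    and C: "0 \<le> C"
  shows "AE \<omega> in M. (\<lambda>k. x k \<omega>) \<longlonglongrightarrow> z"
proof -
  define I where "I m = {m\<^sup>2..<(Suc m)\<^sup>2}" for m :: nat
  define S where "S m \<omega> = (\<Sum>k\<in>I m. norm (x (Suc k) \<omega> - x k \<omega>))" for m \<omega>
  define f where "f m \<omega> = (norm (x (m\<^sup>2) \<omega> - z))\<^sup>2 + (S m \<omega>)\<^sup>2" for m \<omega>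
  have [measurable]: "f m \<in> borel_measurable M" for m
    unfolding f_def S_def by measurable
  have cardI: "card (I m) = 2 * m + 1" for m
    by (simp add: I_def power2_eq_square)
  have S2: "(S m \<omega>)\<^sup>2 \<le> (\<Sum>k\<in>I m. (2 * real m + 1) * (norm (x (Suc k) \<omega> - x k \<omega>))\<^sup>2)" for m \<omega>
    using sum_squared_le_sum_of_squares[of "\<lambda>k. norm (x (Suc k) \<omega> - x k \<omega>)" "I m"]
    by (simp add: S_def cardI sum_distrib_right[symmetric] sum_distrib_left[symmetric] mult.commute add.commute)
  \<comment> \<open>A gap contains \<open>2 * m + 1\<close> increments, each of second moment at
    most \<open>C / (m\<^sup>2 + 1)\<^sup>2\<close>. Cauchy-Schwarz contributes a second factor
    \<open>2 * m + 1\<close>, and \<open>(2 * m + 1)\<^sup>2 \<le> 8 * (m\<^sup>2 + 1)\<close>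
    leaves a summable bound.\<close>
  have "(\<integral>\<^sup>+\<omega>. ennreal ((S m \<omega>)\<^sup>2) \<partial>M) \<le> ennreal (8 * C / (1 + (real m)\<^sup>2))" for m
  proof -
    have "(\<integral>\<^sup>+\<omega>. ennreal ((S m \<omega>)\<^sup>2) \<partial>M)
      \<le> (\<integral>\<^sup>+\<omega>. (\<Sum>k\<in>I m. ennreal (2 * real m + 1) * ennreal ((norm (x (Suc k) \<omega> - x k \<omega>))\<^sup>2)) \<partial>M)"
      using S2 by (intro nn_integral_mono) (simp add: ennreal_mult[symmetric] ennreal_leI del: ennreal_plus)
    also have "\<dots> = (\<Sum>k\<in>I m. ennreal (2 * real m + 1) * (\<integral>\<^sup>+\<omega>. ennreal ((norm (x (Suc k) \<omega> - x k \<omega>))\<^sup>2) \<partial>M))"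
      by (simp add: nn_integral_sum nn_integral_cmult)
    also have "\<dots> \<le> (\<Sum>k\<in>I m. ennreal ((2 * real m + 1) * (C / ((real m)\<^sup>2 + 1)\<^sup>2)))"
    proof (rule sum_mono)
      fix k assume "k \<in> I m"
      then have "real (m\<^sup>2) \<le> real k" unfolding I_def by (subst of_nat_le_iff) simp
      moreover have "0 < (real m)\<^sup>2 + 1" by (simp add: add_nonneg_pos)
      ultimately have "C / (real k + 1)\<^sup>2 \<le> C / ((real m)\<^sup>2 + 1)\<^sup>2"
        using C by (intro divide_left_mono power_mono mult_pos_pos zero_less_power) auto
      then have "(\<integral>\<^sup>+\<omega>. ennreal ((norm (x (Suc k) \<omega> - x k \<omega>))\<^sup>2) \<partial>M) \<le> ennreal (C / ((real m)\<^sup>2 + 1)\<^sup>2)"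
        using incr[of k] by (meson ennreal_leI order_trans)
      then show "ennreal (2 * real m + 1) * (\<integral>\<^sup>+\<omega>. ennreal ((norm (x (Suc k) \<omega> - x k \<omega>))\<^sup>2) \<partial>M)
        \<le> ennreal ((2 * real m + 1) * (C / ((real m)\<^sup>2 + 1)\<^sup>2))"
        using C by (subst ennreal_mult) (auto intro: mult_left_mono)
    qed
    also have "\<dots> = ennreal ((2 * real m + 1)\<^sup>2 * (C / ((real m)\<^sup>2 + 1)\<^sup>2))"
      using C by (subst sum_ennreal) (simp_all add: cardI power2_eq_square[of "1 + 2 * real m"] add.commute)
    also have "\<dots> \<le> ennreal (8 * C / (1 + (real m)\<^sup>2))"
    proof (rule ennreal_leI)
      have "0 \<le> (2 * real m - 1)\<^sup>2" by simp
      then have "(2 * real m + 1)\<^sup>2 \<le> 8 * ((real m)\<^sup>2 + 1)"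
        by (simp add: power2_eq_square algebra_simps)
      then have "(2 * real m + 1)\<^sup>2 * (C / ((real m)\<^sup>2 + 1)\<^sup>2) \<le> 8 * ((real m)\<^sup>2 + 1) * (C / ((real m)\<^sup>2 + 1)\<^sup>2)"
        using C by (intro mult_right_mono) auto
      also have "\<dots> = 8 * C / (1 + (real m)\<^sup>2)"
      proof -
        have "8 * p * (C / p\<^sup>2) = 8 * C / p" if "0 < p" for p :: real
          using that by (simp add: power2_eq_square)
        from this[of "(real m)\<^sup>2 + 1"] show ?thesis
          by (metis add.commute add_nonneg_pos zero_le_power2 zero_less_one)
      qed
      finally show "(2 * real m + 1)\<^sup>2 * (C / ((real m)\<^sup>2 + 1)\<^sup>2) \<le> 8 * C / (1 + (real m)\<^sup>2)" .
    qed
    finally show ?thesis .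
  qed
  moreover have "(\<integral>\<^sup>+\<omega>. ennreal ((norm (x (m\<^sup>2) \<omega> - z))\<^sup>2) \<partial>M) \<le> ennreal (C / (1 + (real m)\<^sup>2))" for m
    using dist[of "m\<^sup>2"] by (simp add: add.commute)
  ultimately have "(\<integral>\<^sup>+\<omega>. ennreal ((norm (x (m\<^sup>2) \<omega> - z))\<^sup>2) \<partial>M) + (\<integral>\<^sup>+\<omega>. ennreal ((S m \<omega>)\<^sup>2) \<partial>M)
      \<le> ennreal (C / (1 + (real m)\<^sup>2)) + ennreal (8 * C / (1 + (real m)\<^sup>2))" for m
    by (intro add_mono)
  moreover have "(\<integral>\<^sup>+\<omega>. ennreal (f m \<omega>) \<partial>M)
    = (\<integral>\<^sup>+\<omega>. ennreal ((norm (x (m\<^sup>2) \<omega> - z))\<^sup>2) \<partial>M) + (\<integral>\<^sup>+\<omega>. ennreal ((S m \<omega>)\<^sup>2) \<partial>M)" for m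
    unfolding f_def S_def by (subst nn_integral_add[symmetric]) auto
  ultimately have f: "(\<integral>\<^sup>+\<omega>. ennreal (f m \<omega>) \<partial>M) \<le> ennreal (9 * C * (1 / (1 + (real m)\<^sup>2)))" for m
    using C by (simp add: ennreal_plus[symmetric] add_divide_distrib[symmetric] del: ennreal_plus)
  have summ: "summable (\<lambda>m. 9 * C * (1 / (1 + (real m)\<^sup>2)))"
  proof (intro summable_mult summable_comparison_test_ev[OF _ inverse_power_summable[of 2]] eventually_sequentiallyI[of 1])
    fix m :: nat assume "1 \<le> m"
    then show "norm (1 / (1 + (real m)\<^sup>2)) \<le> inverse ((real m)\<^sup>2)"
      by (simp add: divide_simps add_nonneg_pos not_less)
  qed simp
  \<comment> \<open>By monotone convergence the expected sum is the sum of the expectations. Since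
    it is finite, the series converges almost surely and its terms tend to 0.\<close>
  have "(\<integral>\<^sup>+\<omega>. (\<Sum>m. ennreal (f m \<omega>)) \<partial>M) = (\<Sum>m. \<integral>\<^sup>+\<omega>. ennreal (f m \<omega>) \<partial>M)"
    by (rule nn_integral_suminf) measurable
  also have "\<dots> \<le> (\<Sum>m. ennreal (9 * C * (1 / (1 + (real m)\<^sup>2))))"
    by (rule suminf_le) (use f in auto)
  also have "\<dots> < \<infinity>"
    using C by (subst suminf_ennreal2[OF _ summ]) auto
  finally have "AE \<omega> in M. (\<Sum>m. ennreal (f m \<omega>)) \<noteq> \<infinity>"
    by (intro nn_integral_PInf_AE) auto
  then show ?thesis
  proof eventually_elim
    case (elim \<omega>)
    then have "summable (\<lambda>m. f m \<omega>)"
      by (intro summable_suminf_not_top) (auto simp: f_def)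
    then have f0: "(\<lambda>m. f m \<omega>) \<longlonglongrightarrow> 0" by (rule summable_LIMSEQ_zero)
    have sq: "sqrt (f m \<omega>) \<ge> norm (x (m\<^sup>2) \<omega> - z)" "sqrt (f m \<omega>) \<ge> S m \<omega>" for m
      by (auto intro!: real_le_rsqrt simp: f_def)
    \<comment> \<open>The last square below \<open>k\<close> lies in the same gap as
      \<open>k\<close>. The distance from that square to \<open>z\<close> and the total movement
      inside the gap are each at most \<open>sqrt (f m)\<close>.\<close>
    have bound: "norm (x k \<omega> - z) \<le> 2 * sqrt (f (floor_sqrt k) \<omega>)" for k
    proof -
      let ?m = "floor_sqrt k"
      have k: "?m\<^sup>2 \<le> k" "k < (Suc ?m)\<^sup>2" by (simp_all add: Suc_floor_sqrt_power2_gt)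
      have "x k \<omega> - x (?m\<^sup>2) \<omega> = (\<Sum>j\<in>{?m\<^sup>2..<k}. x (Suc j) \<omega> - x j \<omega>)"
        using sum_Suc_diff'[OF k(1), of "\<lambda>j. x j \<omega>"] by simp
      then have "norm (x k \<omega> - x (?m\<^sup>2) \<omega>) \<le> (\<Sum>j\<in>{?m\<^sup>2..<k}. norm (x (Suc j) \<omega> - x j \<omega>))"
        by (simp add: norm_sum)
      also have "\<dots> \<le> S ?m \<omega>"
        unfolding S_def I_def using k by (intro sum_mono2) auto
      finally have "norm (x k \<omega> - x (?m\<^sup>2) \<omega>) \<le> sqrt (f ?m \<omega>)" using sq(2) by (rule order_trans)
      moreover have "norm (x k \<omega> - z) \<le> norm (x k \<omega> - x (?m\<^sup>2) \<omega>) + norm (x (?m\<^sup>2) \<omega> - z)"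
        by (metis diff_add_cancel add_diff_eq norm_triangle_ineq)
      ultimately show ?thesis using sq(1)[of ?m] by linarith
    qed
    have "filterlim floor_sqrt at_top at_top"
      unfolding filterlim_at_top
      by (metis (mono_tags, lifting) eventually_sequentiallyI le_floor_sqrtI)
    from filterlim_compose[OF f0 this] have "(\<lambda>k. f (floor_sqrt k) \<omega>) \<longlonglongrightarrow> 0" .
    then have "(\<lambda>k. 2 * sqrt (f (floor_sqrt k) \<omega>)) \<longlonglongrightarrow> 0"
      using tendsto_mult_right_zero tendsto_real_sqrt by fastforce
    then have "(\<lambda>k. norm (x k \<omega> - z)) \<longlonglongrightarrow> 0"
      by (rule Lim_null_comparison[rotated]) (simp add: bound)
    then show ?case using LIM_zero_cancel tendsto_norm_zero_iff by blast
  qed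
qed

section \<open>Vector measurability and conditional moments\<close>

lemma borel_measurable_vec_lambda:
  fixes f :: "'a \<Rightarrow> 'n::finite \<Rightarrow> real"
  assumes "\<And>j. (\<lambda>\<omega>. f \<omega> j) \<in> borel_measurable M"
  shows "(\<lambda>\<omega>. \<chi> j. f \<omega> j) \<in> borel_measurable M"
  by (subst borel_measurable_euclidean_space) (use assms in \<open>auto simp: Basis_vec_def inner_axis\<close>)

lemma borel_measurable_vec_component:
  fixes f :: "'a \<Rightarrow> real^'n::finite"
  assumes "f \<in> borel_measurable M"
  shows "(\<lambda>\<omega>. f \<omega> $ j) \<in> borel_measurable M"
  by (rule measurable_compose[OF assms]) (intro borel_measurable_continuous_onI continuous_intros)

text \<open>Coordinate by coordinate, the \<open>A\<close>-measurable factor is pulled out of the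
  conditional expectation. Boundedness of \<open>Y\<close> makes the products integrable when
  \<open>w\<close> is merely integrable.\<close>

lemma (in prob_space) expectation_cond_mean_zero:
  fixes Y w :: "'a \<Rightarrow> real^'n::finite"
  assumes sub: "subalgebra M A"
    and Y: "Y \<in> borel_measurable A" and Yb: "\<And>\<omega>. \<omega> \<in> space M \<Longrightarrow> norm (Y \<omega>) \<le> K"
    and w: "\<And>j. integrable M (\<lambda>\<omega>. w \<omega> $ j)"
    and mz: "\<And>j. AE \<omega> in M. real_cond_exp M A (\<lambda>\<omega>. w \<omega> $ j) \<omega> = 0"
  shows "integrable M (\<lambda>\<omega>. Y \<omega> \<bullet> w \<omega>)" "(\<integral>\<omega>. Y \<omega> \<bullet> w \<omega> \<partial>M) = 0"
proof -
  interpret sigma_finite_subalgebra M A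
    by (intro finite_measure_subalgebra_is_sigma_finite)
      (simp add: finite_measure_subalgebra_def finite_measure_subalgebra_axioms_def sub finite_measure_axioms)
  have YA: "(\<lambda>\<omega>. Y \<omega> $ j) \<in> borel_measurable A" for j
    using Y by (rule borel_measurable_vec_component)
  have YM [measurable]: "(\<lambda>\<omega>. Y \<omega> $ j) \<in> borel_measurable M" for j
    by (rule measurable_from_subalg[OF sub YA])
  have i: "integrable M (\<lambda>\<omega>. Y \<omega> $ j * w \<omega> $ j)" for j
  proof (rule Bochner_Integration.integrable_bound)
    show "integrable M (\<lambda>\<omega>. K * (w \<omega> $ j))" using w by simp
    show "AE \<omega> in M. norm (Y \<omega> $ j * w \<omega> $ j) \<le> norm (K * (w \<omega> $ j))"
    proof (rule AE_I2)
      fix \<omega> assume "\<omega> \<in> space M"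
      then have "\<bar>Y \<omega> $ j\<bar> \<le> \<bar>K\<bar>" using Yb component_le_norm_cart[of "Y \<omega>" j] by fastforce
      then show "norm (Y \<omega> $ j * w \<omega> $ j) \<le> norm (K * (w \<omega> $ j))"
        by (simp add: abs_mult mult_right_mono)
    qed
    show "(\<lambda>\<omega>. Y \<omega> $ j * w \<omega> $ j) \<in> borel_measurable M"
      using YM w[THEN borel_measurable_integrable] by (intro borel_measurable_times)
  qed
  have "(\<integral>\<omega>. Y \<omega> $ j * w \<omega> $ j \<partial>M) = 0" for j
  proof -
    have "(\<integral>\<omega>. Y \<omega> $ j * w \<omega> $ j \<partial>M) = (\<integral>\<omega>. Y \<omega> $ j * real_cond_exp M A (\<lambda>\<omega>. w \<omega> $ j) \<omega> \<partial>M)"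
      using real_cond_exp_intg(2)[OF i YA] w[THEN borel_measurable_integrable] by simp
    also have "\<dots> = 0"
      using mz[of j] by (intro integral_eq_zero_AE) auto
    finally show ?thesis .
  qed
  then show "integrable M (\<lambda>\<omega>. Y \<omega> \<bullet> w \<omega>)" "(\<integral>\<omega>. Y \<omega> \<bullet> w \<omega> \<partial>M) = 0"
    unfolding inner_vec_def using i by (auto simp: integral_sum)
qed

text \<open>Tower property: testing the conditional expectation with the constant 1 gives the plain
  integral, and the total mass is 1.\<close>

lemma (in prob_space) nn_integral_le_of_nn_cond_exp_le:
  assumes sub: "subalgebra M A" and f: "f \<in> borel_measurable M"
    and le: "AE \<omega> in M. nn_cond_exp M A f \<omega> \<le> C"
  shows "(\<integral>\<^sup>+\<omega>. f \<omega> \<partial>M) \<le> C"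
proof -
  interpret sigma_finite_subalgebra M A
    by (intro finite_measure_subalgebra_is_sigma_finite)
      (simp add: finite_measure_subalgebra_def finite_measure_subalgebra_axioms_def sub finite_measure_axioms)
  have "(\<integral>\<^sup>+\<omega>. f \<omega> \<partial>M) = (\<integral>\<^sup>+\<omega>. nn_cond_exp M A f \<omega> \<partial>M)"
    using nn_cond_exp_intg[of "\<lambda>_. 1" f] f by simp
  also have "\<dots> \<le> (\<integral>\<^sup>+\<omega>. C \<partial>M)" by (rule nn_integral_mono_AE[OF le])
  finally show ?thesis by (simp add: emeasure_space_1)
qed

text \<open>Since \<open>1 - 2 c G \<le> (1 - c G)\<^sup>2\<close>, dividing the recursion by the square of the next stepsize
  makes it telescope; the stepsizes are random, so the weight has to be random as well.\<close>
lemma (in prob_space) mean_square_rate_rec_seq: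
  fixes Y w :: "nat \<Rightarrow> 'a \<Rightarrow> real^'n::finite" and U :: "nat \<Rightarrow> 'a \<Rightarrow> real" and G0 :: "'a \<Rightarrow> real" and c :: real
  defines "G \<equiv> \<lambda>k \<omega>. rec_seq c (G0 \<omega>) k"
  assumes sub: "\<And>k. subalgebra M (A k)" and c: "0 < c" and g: "0 < g" and b: "0 \<le> b"
    and G0: "\<And>\<omega>. \<omega> \<in> space M \<Longrightarrow> g \<le> G0 \<omega>" "\<And>\<omega>. \<omega> \<in> space M \<Longrightarrow> c * G0 \<omega> \<le> 1 / 2"
    and G0A: "\<And>k. G0 \<in> borel_measurable (A k)"
    and UM [measurable]: "\<And>k. U k \<in> borel_measurable M"
    and U: "\<And>k \<omega>. \<omega> \<in> space M \<Longrightarrow> 0 \<le> U k \<omega>" "\<And>k \<omega>. \<omega> \<in> space M \<Longrightarrow> U k \<omega> \<le> B"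
    and YA: "\<And>k. Y k \<in> borel_measurable (A k)"
    and Y: "\<And>k \<omega>. \<omega> \<in> space M \<Longrightarrow> norm (Y k \<omega>) \<le> K"
    and w: "\<And>k j. integrable M (\<lambda>\<omega>. w k \<omega> $ j)"
    and mz: "\<And>k j. AE \<omega> in M. real_cond_exp M (A k) (\<lambda>\<omega>. w k \<omega> $ j) \<omega> = 0"
    and wM [measurable]: "\<And>k. w k \<in> borel_measurable M"
    and var: "\<And>k. (\<integral>\<^sup>+\<omega>. ennreal ((norm (w k \<omega>))\<^sup>2) \<partial>M) \<le> ennreal (nu\<^sup>2)"
    and step: "\<And>k \<omega>. \<omega> \<in> space M \<Longrightarrow> U (Suc k) \<omega> \<le> (1 - 2 * c * G k \<omega>) * U k \<omega>
        + b * (G k \<omega>)\<^sup>2 * (norm (w k \<omega>))\<^sup>2 + G k \<omega> * (Y k \<omega> \<bullet> w k \<omega>)"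
  shows "(\<integral>\<^sup>+\<omega>. ennreal (U k \<omega>) \<partial>M) \<le> ennreal ((B / g\<^sup>2 + 4 * b * nu\<^sup>2) / c\<^sup>2 / (real k + 1))"
proof -
  obtain \<omega>0 where "\<omega>0 \<in> space M" using not_empty by blast
  then have B: "0 \<le> B" using U[of \<omega>0 0] by linarith
  have Gpos: "0 < G k \<omega>" and Gc: "c * G k \<omega> \<le> 1 / 2" and Ginv: "c * G k \<omega> \<le> 1 / (real k + 1)"
    and Glow: "g / 2 ^ k \<le> G k \<omega>" if "\<omega> \<in> space M" for k \<omega>
  proof -
    have pos: "0 < G0 \<omega>" using g G0(1)[OF that] by linarith
    note * = c pos G0(2)[OF that]
    show "0 < G k \<omega>" using rec_seq_bounds[OF *] by (simp add: G_def)
    have "c * G k \<omega> \<le> c * G0 \<omega>" using rec_seq_bounds[OF *] c by (simp add: G_def)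
    then show "c * G k \<omega> \<le> 1 / 2" using G0(2)[OF that] by linarith
    show "c * G k \<omega> \<le> 1 / (real k + 1)" using rec_seq_le_inverse[OF *] by (simp add: G_def)
    have "g / 2 ^ k \<le> G0 \<omega> / 2 ^ k" using G0(1)[OF that] by (intro divide_right_mono) auto
    also have "\<dots> \<le> G k \<omega>" using rec_seq_ge[OF *] by (simp add: G_def)
    finally show "g / 2 ^ k \<le> G k \<omega>" .
  qed
  \<comment> \<open>Every \<open>G l\<close> is a function of \<open>G0\<close> alone, hence
    measurable at every stage \<open>k\<close>. This lets the random weights pass through the
    conditional expectation.\<close>
  have GA': "G l \<in> borel_measurable (A k)" for k l
  proof (induction l)
    case 0 show ?case using G0A by (simp add: G_def)
  next
    case (Suc l) then show ?case by (simp add: G_def)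
  qed
  have GM [measurable]: "G k \<in> borel_measurable M" for k
    by (rule measurable_from_subalg[OF sub GA'])
  define V where "V k \<omega> = U k \<omega> / (G k \<omega>)\<^sup>2" for k \<omega>
  \<comment> \<open>Dividing the noise term \<open>G * (Y \<bullet> w)\<close> by the next squared
    stepsize \<open>G\<^sup>2 * (1 - c * G)\<^sup>2\<close> leaves this coefficient. Its bound below
    grows with \<open>k\<close>, which is harmless: only integrability for each \<open>k\<close> is
    needed.\<close>
  define Z where "Z k \<omega> = (1 / (G k \<omega> * (1 - c * G k \<omega>)\<^sup>2)) *\<^sub>R Y k \<omega>" for k \<omega>
  have ZA: "Z k \<in> borel_measurable (A k)" for k
    unfolding Z_def using GA'[of k] YA[of k] by simp
  have Zb: "norm (Z k \<omega>) \<le> 2 ^ k / g * 4 * K" if "\<omega> \<in> space M" for k \<omega>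
  proof -
    have "(1/2)\<^sup>2 \<le> (1 - c * G k \<omega>)\<^sup>2" using Gc[OF that, of k] by (intro power_mono) auto
    then have "g / 2 ^ k * (1/2)\<^sup>2 \<le> G k \<omega> * (1 - c * G k \<omega>)\<^sup>2"
      using g Glow[OF that, of k] Gpos[OF that, of k] by (intro mult_mono) auto
    then have "1 / (G k \<omega> * (1 - c * G k \<omega>)\<^sup>2) \<le> 1 / (g / 2 ^ k * (1/2)\<^sup>2)"
      using g Gpos[OF that, of k] Gc[OF that, of k]
      by (intro divide_left_mono mult_pos_pos zero_less_power) auto
    also have "\<dots> = 2 ^ k / g * 4" by (simp add: power2_eq_square)
    finally have "1 / (G k \<omega> * (1 - c * G k \<omega>)\<^sup>2) * norm (Y k \<omega>) \<le> 2 ^ k / g * 4 * K"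
      using Y[OF that, of k] g by (intro mult_mono) auto
    then show ?thesis using Gpos[OF that, of k] by (simp add: Z_def)
  qed
  note Zw = expectation_cond_mean_zero[OF sub ZA Zb w mz]
  have Vb: "0 \<le> V k \<omega>" "V k \<omega> \<le> B / (g / 2 ^ k)\<^sup>2" if "\<omega> \<in> space M" for k \<omega>
  proof -
    show "0 \<le> V k \<omega>" using U(1)[OF that] by (simp add: V_def)
    show "V k \<omega> \<le> B / (g / 2 ^ k)\<^sup>2"
      unfolding V_def using g Glow[OF that, of k] U[OF that, of k] B
      by (intro frac_le power_mono) auto
  qed
  have Vi: "integrable M (V k)" for k
  proof (rule integrable_const_bound)
    show "AE \<omega> in M. norm (V k \<omega>) \<le> B / (g / 2 ^ k)\<^sup>2" using Vb by (intro AE_I2) auto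
  qed (unfold V_def, measurable)
  have wi: "integrable M (\<lambda>\<omega>. (norm (w k \<omega>))\<^sup>2)" for k
    using var[of k] by (intro integrableI_bounded) (auto simp: less_top[symmetric] top_unique intro: le_less_trans)
  have wE: "(\<integral>\<omega>. (norm (w k \<omega>))\<^sup>2 \<partial>M) \<le> nu\<^sup>2" for k
    using var[of k] by (intro integral_real_bounded) auto
  have Vstep: "V (Suc k) \<omega> \<le> V k \<omega> + 4 * b * (norm (w k \<omega>))\<^sup>2 + Z k \<omega> \<bullet> w k \<omega>"
    if "\<omega> \<in> space M" for k \<omega>
  proof -
    let ?G = "G k \<omega>" and ?n = "(norm (w k \<omega>))\<^sup>2" and ?y = "Y k \<omega> \<bullet> w k \<omega>"
    define q where "q = 1 - c * ?G"
    have q: "1/2 \<le> q" using Gc[OF that, of k] by (simp add: q_def)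
    then have q2: "1/4 \<le> q\<^sup>2" using power_mono[of "1/2" q 2] by (simp add: power2_eq_square)
    have G: "0 < ?G" by (rule Gpos[OF that])
    have "V (Suc k) \<omega> = U (Suc k) \<omega> / (?G\<^sup>2 * q\<^sup>2)"
      by (simp add: V_def G_def q_def power_mult_distrib)
    also have "\<dots> \<le> ((1 - 2 * c * ?G) * U k \<omega> + b * ?G\<^sup>2 * ?n + ?G * ?y) / (?G\<^sup>2 * q\<^sup>2)"
      by (intro divide_right_mono step that) auto
    also have "\<dots> = (1 - 2 * c * ?G) * U k \<omega> / (?G\<^sup>2 * q\<^sup>2) + b * ?n / q\<^sup>2 + ?y / (?G * q\<^sup>2)"
      using G q by (simp add: add_divide_distrib power2_eq_square)
    \<comment> \<open>The contraction factor is replaced by \<open>q\<^sup>2\<close>, which cancels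
      and restores \<open>V k\<close>. The noise variance loses only the constant 4, because
      \<open>q \<ge> 1/2\<close>.\<close>
    also have "\<dots> \<le> q\<^sup>2 * U k \<omega> / (?G\<^sup>2 * q\<^sup>2) + b * ?n / (1/4) + ?y / (?G * q\<^sup>2)"
    proof (intro add_mono divide_right_mono mult_right_mono divide_left_mono order_refl)
      show "1 - 2 * c * ?G \<le> q\<^sup>2"
        using zero_le_power2[of "c * ?G"] by (simp add: q_def power2_eq_square algebra_simps)
    qed (use U(1)[OF that] b q2 G in auto)
    also have "q\<^sup>2 * U k \<omega> / (?G\<^sup>2 * q\<^sup>2) = V k \<omega>" using q by (simp add: V_def)
    also have "?y / (?G * q\<^sup>2) = Z k \<omega> \<bullet> w k \<omega>" by (simp add: Z_def q_def)
    finally show ?thesis by simp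
  qed
  \<comment> \<open>The centred term has expectation 0, so each step adds at most
    \<open>4 * b * nu\<^sup>2\<close>.\<close>
  have EV: "(\<integral>\<omega>. V k \<omega> \<partial>M) \<le> B / g\<^sup>2 + 4 * b * nu\<^sup>2 * real k" for k
  proof (induction k)
    case 0
    have "(\<integral>\<omega>. V 0 \<omega> \<partial>M) \<le> B / g\<^sup>2"
      using Vb(2)[of _ 0] by (intro integral_le_const Vi AE_I2) auto
    then show ?case by simp
  next
    case (Suc k)
    have "(\<integral>\<omega>. V (Suc k) \<omega> \<partial>M) \<le> (\<integral>\<omega>. V k \<omega> + 4 * b * (norm (w k \<omega>))\<^sup>2 + Z k \<omega> \<bullet> w k \<omega> \<partial>M)"
      using Vi wi Zw Vstep by (intro integral_mono) auto
    also have "\<dots> = (\<integral>\<omega>. V k \<omega> \<partial>M) + 4 * b * (\<integral>\<omega>. (norm (w k \<omega>))\<^sup>2 \<partial>M)"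
      using Vi wi Zw by simp
    also have "\<dots> \<le> (B / g\<^sup>2 + 4 * b * nu\<^sup>2 * real k) + 4 * b * nu\<^sup>2"
      using Suc wE b by (intro add_mono mult_left_mono) auto
    finally show ?case by (simp add: algebra_simps)
  qed
  have Ui: "integrable M (U k)"
  proof (rule integrable_const_bound)
    show "AE \<omega> in M. norm (U k \<omega>) \<le> B" using U by (intro AE_I2) auto
  qed measurable
  \<comment> \<open>Back from \<open>V\<close> to \<open>U = V * G\<^sup>2\<close>: the
    deterministic bound \<open>G \<le> 1 / (c * (k + 1))\<close> turns linear growth of the weighted
    mean into decay of order \<open>1/k\<close>.\<close>
  have "(\<integral>\<omega>. U k \<omega> \<partial>M) \<le> (\<integral>\<omega>. V k \<omega> / (c * (real k + 1))\<^sup>2 \<partial>M)"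
  proof (intro integral_mono Ui)
    fix \<omega> assume \<omega>: "\<omega> \<in> space M"
    have "G k \<omega> * (c * (real k + 1)) \<le> 1"
      using Ginv[OF \<omega>, of k] by (subst (asm) pos_le_divide_eq) (auto simp: algebra_simps)
    then have "G k \<omega> \<le> 1 / (c * (real k + 1))" using c by (subst pos_le_divide_eq) auto
    then have "(G k \<omega>)\<^sup>2 \<le> (1 / (c * (real k + 1)))\<^sup>2"
      using Gpos[OF \<omega>, of k] by (intro power_mono) auto
    then have "V k \<omega> * (G k \<omega>)\<^sup>2 \<le> V k \<omega> * (1 / (c * (real k + 1)))\<^sup>2"
      using Vb(1)[OF \<omega>] by (intro mult_left_mono)
    then show "U k \<omega> \<le> V k \<omega> / (c * (real k + 1))\<^sup>2"
      using Gpos[OF \<omega>, of k] by (simp add: V_def power_divide)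
  qed (use Vi in auto)
  also have "\<dots> = (\<integral>\<omega>. V k \<omega> \<partial>M) / (c * (real k + 1))\<^sup>2" by simp
  also have "\<dots> \<le> ((B / g\<^sup>2 + 4 * b * nu\<^sup>2) * (real k + 1)) / (c * (real k + 1))\<^sup>2"
  proof (intro divide_right_mono order_trans[OF EV])
    have "0 \<le> B / g\<^sup>2 * real k" "0 \<le> 4 * b * nu\<^sup>2" using B b by auto
    then show "B / g\<^sup>2 + 4 * b * nu\<^sup>2 * real k \<le> (B / g\<^sup>2 + 4 * b * nu\<^sup>2) * (real k + 1)"
      by (simp only: distrib_left distrib_right mult_1_right)
  qed simp
  also have "\<dots> = (B / g\<^sup>2 + 4 * b * nu\<^sup>2) / c\<^sup>2 / (real k + 1)"
    by (simp add: power_mult_distrib power2_eq_square)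
  finally have "(\<integral>\<omega>. U k \<omega> \<partial>M) \<le> (B / g\<^sup>2 + 4 * b * nu\<^sup>2) / c\<^sup>2 / (real k + 1)" .
  moreover have "(\<integral>\<^sup>+\<omega>. ennreal (U k \<omega>) \<partial>M) = ennreal (\<integral>\<omega>. U k \<omega> \<partial>M)"
    using U(1) by (intro nn_integral_eq_integral Ui AE_I2)
  ultimately show ?thesis by (simp add: ennreal_leI)
qed

section \<open>Natural filtration and the initial diameter\<close>

lemma space_nat_filtr [simp]: "space (nat_filtr M S x0 xi k) = space M"
  unfolding nat_filtr_def by (rule space_measure_of) auto

lemma sets_nat_filtr:
  "sets (nat_filtr M S x0 xi k) = sigma_sets (space M)
     ({x0 -` A \<inter> space M | A. A \<in> sets borel} \<union> {xi j -` B \<inter> space M | j B. j < k \<and> B \<in> sets S})"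
  unfolding nat_filtr_def by (rule sets_measure_of) auto

lemma subalgebra_nat_filtr:
  assumes "x0 \<in> borel_measurable M" "\<And>k. xi k \<in> measurable M S"
  shows "subalgebra M (nat_filtr M S x0 xi k)"
  unfolding subalgebra_def sets_nat_filtr
  using assms by (auto intro!: sets.sigma_sets_subset measurable_sets)

lemma measurable_nat_filtr_init: "x0 \<in> borel_measurable (nat_filtr M S x0 xi k)"
  by (rule measurableI) (auto simp: sets_nat_filtr intro!: sigma_sets.Basic)

lemma measurable_nat_filtr_sample:
  assumes "xi j \<in> measurable M S" "j < k"
  shows "xi j \<in> measurable (nat_filtr M S x0 xi k) S"
  using assms by (intro measurableI) (auto simp: sets_nat_filtr dest: measurable_space intro!: sigma_sets.Basic)

section \<open>The largest distance from the initial point\<close>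

lemma bdd_above_norm_diff: "bounded X \<Longrightarrow> bdd_above ((\<lambda>x. norm (x - y)) ` X)"
  for y :: "'v::real_normed_vector"
proof -
  assume "bounded X"
  then obtain B where "\<And>x. x \<in> X \<Longrightarrow> norm x \<le> B" by (auto simp: bounded_iff)
  then have "norm (x - y) \<le> B + norm y" if "x \<in> X" for x
    using that norm_triangle_ineq4[of x y] by fastforce
  then show ?thesis by (rule bdd_aboveI2)
qed

lemma norm_le_diamD: "bounded X \<Longrightarrow> x \<in> X \<Longrightarrow> norm (x - y) \<le> diamD X y"
  unfolding diamD_def by (rule cSUP_upper[OF _ bdd_above_norm_diff])

text \<open>A supremum of 1-Lipschitz functions is 1-Lipschitz. Continuity makes the random
  diameter, and with it every stepsize, measurable with respect to the initial point.\<close>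

lemma continuous_on_diamD:
  fixes X :: "(real^'n::finite) set"
  assumes "bounded X" "X \<noteq> {}"
  shows "continuous_on UNIV (diamD X)"
proof -
  have le: "diamD X y \<le> diamD X z + norm (y - z)" for y z
    unfolding diamD_def[of X y]
  proof (rule cSUP_least[OF assms(2)])
    fix x assume "x \<in> X"
    then have "norm (x - z) \<le> diamD X z" by (rule norm_le_diamD[OF assms(1)])
    then show "norm (x - y) \<le> diamD X z + norm (y - z)"
      using norm_triangle_ineq4[of "x - z" "y - z"] by simp
  qed
  have "1-lipschitz_on UNIV (diamD X)"
  proof (rule lipschitz_onI)
    fix y z :: "real^'n"
    show "dist (diamD X y) (diamD X z) \<le> 1 * dist y z"
      using le[of y z] le[of z y] by (simp add: dist_norm dist_real_def abs_le_iff norm_minus_commute)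
  qed simp
  then show ?thesis by (rule lipschitz_on_continuous_on)
qed

section \<open>Stepsizes of the scheme\<close>

text \<open>The lower bound on \<open>nu\<close> says
  \<open>D\<^sup>2 * L\<^sup>2 \<le> 2 * nu\<^sup>2\<close>, which is precisely what places the
  initial stepsize in the feasible interval. Together with \<open>2 * c \<le> L\<close> it yields
  \<open>4 * c\<^sup>2 * g \<le> L\<^sup>2 * g \<le> 2 * c\<close>, hence the last bound.\<close>

lemma initial_stepsize_bounds:
  fixes L c nu \<beta> D :: real
  assumes L: "0 < L" and c: "0 < c" "2 * c \<le> L" and \<beta>: "0 \<le> \<beta>" and nu: "0 < nu" and D: "0 < D"
    and nu_ge: "D * L / sqrt 2 \<le> nu"
  defines "g \<equiv> c * D\<^sup>2 / ((1 + \<beta>)\<^sup>2 * nu\<^sup>2)"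
  shows "0 < g" "(1 + \<beta>)\<^sup>2 * L\<^sup>2 * g \<le> 2 * c" "c * g \<le> 1 / 2"
proof -
  show g: "0 < g" using assms by (auto simp: g_def intro!: divide_pos_pos mult_pos_pos)
  have "(D * L / sqrt 2)\<^sup>2 \<le> nu\<^sup>2" using L D nu_ge by (intro power_mono) auto
  then have DL: "D\<^sup>2 * L\<^sup>2 \<le> 2 * nu\<^sup>2" by (simp add: power_divide power_mult_distrib)
  have "(1 + \<beta>)\<^sup>2 * L\<^sup>2 * g = c * (D\<^sup>2 * L\<^sup>2) / nu\<^sup>2" using \<beta> by (simp add: g_def)
  also have "\<dots> \<le> c * (2 * nu\<^sup>2) / nu\<^sup>2" using DL c by (intro divide_right_mono mult_left_mono) auto
  finally show *: "(1 + \<beta>)\<^sup>2 * L\<^sup>2 * g \<le> 2 * c" using nu by simp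
  have "1 \<le> (1 + \<beta>)\<^sup>2" using \<beta> by simp
  then have "1 * (L\<^sup>2 * g) \<le> (1 + \<beta>)\<^sup>2 * (L\<^sup>2 * g)" using g by (intro mult_right_mono) auto
  with * have "L\<^sup>2 * g \<le> 2 * c" by (simp add: mult.assoc)
  moreover have "(2 * c)\<^sup>2 \<le> L\<^sup>2" using c by (intro power_mono) auto
  then have "(2 * c)\<^sup>2 * g \<le> L\<^sup>2 * g" using g by (intro mult_right_mono) auto
  ultimately have "2 * c * (2 * (c * g)) \<le> 2 * c * 1" by (simp add: power2_eq_square algebra_simps)
  then show "c * g \<le> 1 / 2" using c by (subst (asm) mult_le_cancel_left_pos) auto
qed

lemma stepsize_eq_scaled:
  assumes "r \<noteq> 0"
  shows "stepsize L eta nu c r D k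
    = r * rec_seq c (c * D\<^sup>2 / ((1 + (eta - 2 * c) / L)\<^sup>2 * nu\<^sup>2)) k"
  using rec_seq_scale[OF assms, of c "c * D\<^sup>2 / ((1 + (eta - 2 * c) / L)\<^sup>2 * nu\<^sup>2)" k]
  by (simp add: stepsize_def mult.assoc)

text \<open>Cauchy-Schwarz at a single pair of distinct points. This is where nontriviality of the
  feasible set enters the comparison of the two constants.\<close>

lemma strongly_monotone_le_lipschitz:
  fixes F :: "'v::real_inner \<Rightarrow> 'v"
  assumes "x \<noteq> y" and lip: "norm (F x - F y) \<le> L * norm (x - y)"
    and mono: "(F x - F y) \<bullet> (x - y) \<ge> eta * (norm (x - y))\<^sup>2"
  shows "eta \<le> L"
proof -
  have "eta * (norm (x - y))\<^sup>2 \<le> norm (F x - F y) * norm (x - y)"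
    using mono norm_cauchy_schwarz order_trans by blast
  also have "\<dots> \<le> (L * norm (x - y)) * norm (x - y)" using lip by (intro mult_right_mono) auto
  finally show ?thesis using assms(1) by (simp add: power2_eq_square mult_le_cancel_right)
qed

lemma stepsize_bounds_and_optimality:
  fixes L eta nu c D :: real and r :: "'b::finite \<Rightarrow> real"
  assumes L: "0 < L" "eta \<le> L" and c: "0 < c" "c < eta / 2" and nu: "0 < nu" and D: "0 < D"
    and nu_ge: "D * L / sqrt 2 \<le> nu"
    and r: "\<And>i. 1 \<le> r i" "\<And>i. r i \<le> 1 + (eta - 2*c) / L"
  shows "let gam = (\<lambda>k i. stepsize L eta nu c (r i) D k);
              \<beta> = (eta - 2*c) / L;
              e0 = D^2;
              ds = rec_seq ((eta - \<beta>*L)/2) ((eta - \<beta>*L) / (2*(1+\<beta>)^2*nu^2) * e0);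
              Gs = rec_seq ((eta - \<beta>*L)/(2*(1+\<beta>))) ((eta - \<beta>*L) / (2*(1+\<beta>)*nu^2) * e0);
              e = err_fun (eta - \<beta>*L) ((1+\<beta>)^2*nu^2) e0;
              bnd = (eta - \<beta>*L) / ((1+\<beta>)^2 * L^2)
          in (\<forall>i j k. gam k i / r i = gam k j / r j)
           \<and> (\<forall>k. ds k \<le> Min (range (gam k)) \<and> Gs k \<ge> Max (range (gam k))
                  \<and> (Gs k - ds k) / ds k \<le> \<beta>)
           \<and> 0 \<le> \<beta> \<and> \<beta> < eta / L
           \<and> (\<forall>k. e ds k = 2*(1+\<beta>)^2*nu^2 / (eta - \<beta>*L) * ds k)
           \<and> (\<forall>k\<ge>1. \<forall>d. (\<forall>j<k. 0 < d j \<and> d j \<le> bnd) \<longrightarrow>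
                 (\<forall>j<k. 0 < ds j \<and> ds j \<le> bnd)
               \<and> e d k - e ds k \<ge> (1+\<beta>)^2*nu^2*(d (k-1) - ds (k-1))^2
               \<and> e ds k \<le> e d k)"
proof -
  define \<beta> where "\<beta> = (eta - 2*c) / L"
  define g0 where "g0 = c * D\<^sup>2 / ((1 + \<beta>)\<^sup>2 * nu\<^sup>2)"
  define ds where "ds = rec_seq c g0"
  define b where "b = (1+\<beta>)\<^sup>2 * nu\<^sup>2"
  have \<beta>: "0 \<le> \<beta>" using L c by (simp add: \<beta>_def)
  \<comment> \<open>This identity ties the scheme to the optimization problem: the lower envelope
    becomes the recursion with constant \<open>c\<close>, and the upper one is its multiple by
    \<open>1 + \<beta>\<close>. Everything in the conclusion is then read off from
    \<open>1 \<le> r i \<le> 1 + \<beta>\<close>.\<close>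
  have a: "eta - \<beta> * L = 2 * c" using L by (simp add: \<beta>_def)
  have c2: "2 * c \<le> L" using c L by linarith
  note g0 = initial_stepsize_bounds[OF L(1) c(1) c2 \<beta> nu D nu_ge, folded g0_def]
  have ds: "0 < ds k" "ds k \<le> g0" for k
    using rec_seq_bounds[OF c(1) g0(1,3)] by (auto simp: ds_def)
  have gam: "stepsize L eta nu c (r i) D k = r i * ds k" for i k
    using r(1)[of i] by (subst stepsize_eq_scaled) (auto simp: ds_def g0_def \<beta>_def)
  have ds_eq: "rec_seq ((eta - \<beta>*L)/2) ((eta - \<beta>*L) / (2*(1+\<beta>)\<^sup>2*nu\<^sup>2) * D\<^sup>2) = ds"
    unfolding a ds_def g0_def by (simp add: mult.assoc)
  have Gs_eq: "rec_seq ((eta - \<beta>*L)/(2*(1+\<beta>))) ((eta - \<beta>*L) / (2*(1+\<beta>)*nu\<^sup>2) * D\<^sup>2) k = (1 + \<beta>) * ds k" for k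
  proof -
    have "(1 + \<beta>) * g0 = c * D\<^sup>2 / ((1 + \<beta>) * nu\<^sup>2)"
      using \<beta> by (simp add: g0_def power2_eq_square[of "1 + \<beta>"])
    moreover have "2 * c / (2 * (1+\<beta>)) = c / (1+\<beta>)"
      "2 * c / (2 * (1+\<beta>) * nu\<^sup>2) * D\<^sup>2 = c * D\<^sup>2 / ((1+\<beta>) * nu\<^sup>2)"
      using mult_divide_mult_cancel_left[of 2 c "1 + \<beta>"]
        mult_divide_mult_cancel_left[of 2 c "(1 + \<beta>) * nu\<^sup>2"] by (simp_all only: mult.assoc) auto
    moreover have "1 + \<beta> \<noteq> 0" using \<beta> by linarith
    ultimately show ?thesis
      unfolding a ds_def using rec_seq_scale[of "1 + \<beta>" c g0 k] by (simp only: simp_thms)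
  qed
  have b: "0 < b" using \<beta> nu by (simp add: b_def)
  have e0: "D\<^sup>2 = 2 * b / (2 * c) * g0" using c b by (simp add: g0_def b_def[symmetric])
  define bnd where "bnd = 2 * c / ((1+\<beta>)\<^sup>2 * L\<^sup>2)"
  have p: "0 < (1+\<beta>)\<^sup>2 * L\<^sup>2" using \<beta> L by simp
  have "g0 \<le> bnd" using g0(2) p by (simp add: bnd_def pos_le_divide_eq mult.commute)
  then have dsb: "ds k \<le> bnd" for k using ds(2) order_trans by blast
  \<comment> \<open>Feasible steps keep the contraction factor \<open>1 - 2 * c * d\<close>
    nonnegative, as \<open>4 * c\<^sup>2 \<le> L\<^sup>2 \<le> (1 + \<beta>)\<^sup>2 *
    L\<^sup>2\<close>. The optimality induction requires this.\<close>
  have bnd1: "2 * c * bnd \<le> 1"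
  proof -
    have "(2 * c) * (2 * c) \<le> L * L" using c c2 by (intro mult_mono) auto
    moreover have "1 * L\<^sup>2 \<le> (1+\<beta>)\<^sup>2 * L\<^sup>2" using \<beta> by (intro mult_right_mono) auto
    ultimately have "(2 * c) * (2 * c) \<le> (1+\<beta>)\<^sup>2 * L\<^sup>2" by (simp add: power2_eq_square)
    then show ?thesis using p by (simp add: bnd_def pos_divide_le_eq)
  qed
  have opt: "err_fun (2 * c) b (D\<^sup>2) d k - err_fun (2 * c) b (D\<^sup>2) ds k \<ge> b * (d (k - 1) - ds (k - 1))\<^sup>2"
    if "1 \<le> k" "\<And>j. j < k \<Longrightarrow> d j \<le> bnd" for k d
  proof -
    have "2 * c * d j \<le> 1" if "j < k" for j
    proof -
      have "2 * c * d j \<le> 2 * c * bnd" using \<open>\<And>j. j < k \<Longrightarrow> d j \<le> bnd\<close>[OF that] c by (intro mult_left_mono) auto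
      then show ?thesis using bnd1 by linarith
    qed
    then show ?thesis
      using err_fun_minus_optimal[OF _ less_imp_le[OF b] e0, of k d] c that(1) by (simp add: ds_def)
  qed
  have opt': "err_fun (2 * c) b (D\<^sup>2) ds k \<le> err_fun (2 * c) b (D\<^sup>2) d k"
    if "1 \<le> k" "\<And>j. j < k \<Longrightarrow> d j \<le> bnd" for k d
  proof -
    have "0 \<le> b * (d (k - 1) - ds (k - 1))\<^sup>2" using b by simp
    also have "\<dots> \<le> err_fun (2 * c) b (D\<^sup>2) d k - err_fun (2 * c) b (D\<^sup>2) ds k"
      using that by (intro opt)
    finally show ?thesis by simp
  qed
  have val: "err_fun (2 * c) b (D\<^sup>2) ds k = 2 * (1+\<beta>)\<^sup>2 * nu\<^sup>2 / (2 * c) * ds k" for k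
    using err_fun_rec_seq[of "2 * c" "D\<^sup>2" b g0 k] c e0 by (simp add: ds_def b_def mult.assoc)
  have min: "ds k \<le> Min (range (\<lambda>i. r i * ds k))" for k
    using r(1) ds(1)[of k] by simp
  have max: "Max (range (\<lambda>i. r i * ds k)) \<le> (1 + \<beta>) * ds k" for k
    using r(2) ds(1)[of k] by (simp add: \<beta>_def mult_right_mono)
  have ratio: "((1 + \<beta>) * ds k - ds k) / ds k \<le> \<beta>" for k
    using ds(1)[of k] by (simp add: algebra_simps)
  have quot: "r i * ds k / r i = r j * ds k / r j" for i j k
    using r(1)[of i] r(1)[of j] by simp
  have "\<beta> < eta / L" using L c by (simp add: \<beta>_def divide_strict_right_mono)
  then show ?thesis
    unfolding Let_def \<beta>_def[symmetric] ds_eq Gs_eq gam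
    unfolding a b_def[symmetric] bnd_def[symmetric]
    using quot min max ratio \<beta> val ds(1) dsb opt opt'
    by (intro conjI allI impI) auto
qed

section \<open>The stochastic scheme\<close>

text \<open>\<open>D\<close> and \<open>G\<close> are random variables, since the diameter is
  measured from the random initial point. \<open>G\<close> is the factor common to all blocks: block
  \<open>i\<close> uses the stepsize \<open>r i * G k\<close>.\<close>

locale cartesian_svi = prob_space M
  for M :: "'w measure" +
  fixes S :: "'s measure"
    and blk :: "'n::finite \<Rightarrow> 'b::finite" and Xb :: "'b \<Rightarrow> (real^'n) set"
    and F :: "real^'n \<Rightarrow> real^'n" and Phi :: "real^'n \<Rightarrow> 's \<Rightarrow> real^'n"
    and xi :: "nat \<Rightarrow> 'w \<Rightarrow> 's" and x0 :: "'w \<Rightarrow> real^'n"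
    and L eta nu c :: real and r :: "'b \<Rightarrow> real"
  fixes X x w \<beta> D G
  defines "X \<equiv> cartprod blk Xb"
    and "x \<equiv> \<lambda>k \<omega>. scheme_iter blk Xb F Phi xi x0 L eta nu c r \<omega> k"
    and "w \<equiv> \<lambda>k \<omega>. Phi (x k \<omega>) (xi k \<omega>) - F (x k \<omega>)"
    and "\<beta> \<equiv> (eta - 2 * c) / L"
    and "D \<equiv> \<lambda>\<omega>. diamD X (x0 \<omega>)"
    and "G \<equiv> \<lambda>k \<omega>. rec_seq c (c * (D \<omega>)\<^sup>2 / ((1 + \<beta>)\<^sup>2 * nu\<^sup>2)) k"
  assumes Xb_sub: "\<And>i. Xb i \<subseteq> blockspace blk i"
    and Xb_ne: "\<And>i. Xb i \<noteq> {}"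
    and Xb_closed: "\<And>i. closed (Xb i)"
    and Xb_convex: "\<And>i. convex (Xb i)"
    and X_bounded: "bounded X"
    and X_nontriv: "\<exists>x\<in>X. \<exists>y\<in>X. x \<noteq> y"
    and Phi_meas: "(\<lambda>p. Phi (fst p) (snd p)) \<in> borel_measurable (borel \<Otimes>\<^sub>M S)"
    and L_pos: "L > 0"
    and lipschitz: "\<And>x y. x \<in> X \<Longrightarrow> y \<in> X \<Longrightarrow> norm (F x - F y) \<le> L * norm (x - y)"
    and eta_pos: "eta > 0"
    and strongly_monotone: "\<And>x y. x \<in> X \<Longrightarrow> y \<in> X \<Longrightarrow>
          (F x - F y) \<bullet> (x - y) \<ge> eta * (norm (x - y))\<^sup>2"
    and x0_meas: "x0 \<in> borel_measurable M"
    and x0_in: "\<And>\<omega>. \<omega> \<in> space M \<Longrightarrow> x0 \<omega> \<in> X"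
    and xi_meas: "\<And>k. xi k \<in> measurable M S"
    and w_int: "\<And>k j. integrable M (\<lambda>\<omega>. w k \<omega> $ j)"
    and w_mean_zero: "\<And>k j. AE \<omega> in M. real_cond_exp M (nat_filtr M S x0 xi k) (\<lambda>\<omega>. w k \<omega> $ j) \<omega> = 0"
    and nu_pos: "nu > 0"
    and w_var: "\<And>k. AE \<omega> in M. nn_cond_exp M (nat_filtr M S x0 xi k)
          (\<lambda>\<omega>. ennreal ((norm (w k \<omega>))\<^sup>2)) \<omega> \<le> ennreal (nu\<^sup>2)"
    and c_pos: "0 < c" and c_less: "c < eta / 2"
    and r_ge: "\<And>i. 1 \<le> r i" and r_le: "\<And>i. r i \<le> 1 + \<beta>"
    and nu_ge: "\<And>\<omega>. \<omega> \<in> space M \<Longrightarrow> D \<omega> * L / sqrt 2 \<le> nu"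
begin

lemma X_closed: "closed X" and X_convex: "convex X" and X_ne: "X \<noteq> {}"
  unfolding X_def using closed_cartprod convex_cartprod cartprod_nonempty Xb_sub Xb_ne Xb_closed Xb_convex
  by (blast+)

lemma eta_le_L: "eta \<le> L"
  using X_nontriv strongly_monotone_le_lipschitz lipschitz strongly_monotone by metis

lemma beta_nonneg: "0 \<le> \<beta>"
  using L_pos c_less by (simp add: \<beta>_def)

text \<open>Of two fixed distinct points, at least one is half their distance away from any initial
  point. The resulting bound is deterministic, so the random stepsizes are uniformly bounded below
  at each \<open>k\<close>.\<close>

lemma diam_lower_bound: "\<exists>d>0. \<forall>\<omega>\<in>space M. d \<le> D \<omega>"
proof -
  obtain y z where yz: "y \<in> X" "z \<in> X" "y \<noteq> z" using X_nontriv by blast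
  have "norm (y - z) / 2 \<le> D \<omega>" for \<omega>
    using norm_le_diamD[OF X_bounded yz(1), of "x0 \<omega>"] norm_le_diamD[OF X_bounded yz(2), of "x0 \<omega>"]
      norm_triangle_ineq4[of "y - x0 \<omega>" "z - x0 \<omega>"] by (simp add: D_def)
  then show ?thesis using yz(3) by (intro exI[of _ "norm (y - z) / 2"]) auto
qed

lemma D_pos: "\<omega> \<in> space M \<Longrightarrow> 0 < D \<omega>"
  using diam_lower_bound by fastforce

lemma G_bounds:
  assumes "\<omega> \<in> space M"
  shows "0 < G k \<omega>" "(1 + \<beta>)\<^sup>2 * L\<^sup>2 * G k \<omega> \<le> eta - \<beta> * L" "c * G k \<omega> \<le> 1 / (real k + 1)"
    "c * G 0 \<omega> \<le> 1 / 2"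
proof -
  let ?g = "c * (D \<omega>)\<^sup>2 / ((1 + \<beta>)\<^sup>2 * nu\<^sup>2)"
  have "2 * c \<le> L" using c_less eta_le_L by linarith
  note g = initial_stepsize_bounds[OF L_pos c_pos this beta_nonneg nu_pos D_pos[OF assms] nu_ge[OF assms]]
  note G = rec_seq_bounds[OF c_pos g(1,3), of k]
  show "0 < G k \<omega>" using G by (simp add: G_def)
  have "(1 + \<beta>)\<^sup>2 * L\<^sup>2 * G k \<omega> \<le> (1 + \<beta>)\<^sup>2 * L\<^sup>2 * ?g" using G by (intro mult_left_mono) (auto simp: G_def)
  also have "\<dots> \<le> 2 * c" by (rule g(2))
  finally show "(1 + \<beta>)\<^sup>2 * L\<^sup>2 * G k \<omega> \<le> eta - \<beta> * L" using L_pos by (simp add: \<beta>_def)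
  show "c * G k \<omega> \<le> 1 / (real k + 1)" using rec_seq_le_inverse[OF c_pos g(1,3), of k] by (simp add: G_def)
  show "c * G 0 \<omega> \<le> 1 / 2" using g(3) by (simp add: G_def)
qed

lemma x_0: "x 0 \<omega> = x0 \<omega>"
  by (simp add: x_def scheme_iter_def)

lemma x_Suc: "x (Suc k) \<omega> =
    closest_point X (x k \<omega> - (\<chi> j. r (blk j) * G k \<omega> * Phi (x k \<omega>) (xi k \<omega>) $ j))"
proof -
  have "stepsize L eta nu c (r i) (diamD (cartprod blk Xb) (x0 \<omega>)) k = r i * G k \<omega>" for i
    using r_ge[of i] by (subst stepsize_eq_scaled) (auto simp: G_def D_def X_def \<beta>_def)
  then show ?thesis
    unfolding x_def scheme_iter_def dsa_iter_Suc_closest_point[OF Xb_sub Xb_ne Xb_closed Xb_convex]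
    by (simp add: Let_def X_def)
qed

lemma x_in: "\<omega> \<in> space M \<Longrightarrow> x k \<omega> \<in> X"
  by (cases k) (auto simp: x_0 x_Suc x0_in intro: closest_point_in_set[OF X_closed X_ne])

section \<open>Adaptedness of the iterates to the filtration\<close>

abbreviation "A \<equiv> nat_filtr M S x0 xi"

lemma subalgebra_filtration: "subalgebra M (A k)"
  by (rule subalgebra_nat_filtr[OF x0_meas xi_meas])

lemma D_meas: "D \<in> borel_measurable (A k)"
  unfolding D_def
  by (rule measurable_compose[OF measurable_nat_filtr_init])
    (intro borel_measurable_continuous_onI continuous_on_diamD X_bounded X_ne)

lemma G_meas: "G l \<in> borel_measurable (A k)"
proof (induction l)
  case 0 then show ?case using D_meas by (simp add: G_def)
next
  case (Suc l) then show ?case by (simp add: G_def)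
qed

lemma closest_point_X_meas: "closest_point X \<in> borel_measurable borel"
  by (intro borel_measurable_continuous_onI continuous_on_closest_point X_convex X_closed X_ne)

text \<open>Computing \<open>x k\<close> uses the initial point and only the samples with index
  below \<open>k\<close>. Fixing the stage \<open>m\<close> beforehand keeps the induction inside
  one sigma-algebra.\<close>

lemma x_meas: "k \<le> m \<Longrightarrow> x k \<in> borel_measurable (A m)"
proof (induction k)
  case 0
  have "x 0 = x0" by (auto simp: x_0)
  then show ?case using measurable_nat_filtr_init by simp
next
  case (Suc k)
  then have xk: "x k \<in> borel_measurable (A m)" by simp
  have "xi k \<in> measurable (A m) S"
    using Suc.prems by (intro measurable_nat_filtr_sample xi_meas) simp
  then have "(\<lambda>\<omega>. Phi (x k \<omega>) (xi k \<omega>)) \<in> borel_measurable (A m)"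
    using measurable_compose[OF measurable_Pair[OF xk] Phi_meas] by simp
  then have "(\<lambda>\<omega>. x k \<omega> - (\<chi> j. r (blk j) * G k \<omega> * Phi (x k \<omega>) (xi k \<omega>) $ j)) \<in> borel_measurable (A m)"
    using xk G_meas[of k m]
    by (intro borel_measurable_diff borel_measurable_vec_lambda borel_measurable_times
        borel_measurable_const borel_measurable_vec_component)
  from measurable_compose[OF this closest_point_X_meas]
  show ?case by (simp add: x_Suc[abs_def])
qed

text \<open>The assumptions make \<open>F\<close> continuous only on \<open>X\<close>. Composing it
  with the projection gives a map continuous everywhere that agrees with \<open>F\<close> at the
  iterates.\<close>

lemma F_x_meas: "(\<lambda>\<omega>. F (x k \<omega>)) \<in> borel_measurable (A k)"
proof -
  have "L-lipschitz_on X F"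
    using L_pos lipschitz by (intro lipschitz_onI) (auto simp: dist_norm)
  then have "continuous_on UNIV (F \<circ> closest_point X)"
    using X_closed X_ne
    by (intro continuous_on_compose continuous_on_closest_point X_convex)
      (auto intro!: continuous_on_subset[OF lipschitz_on_continuous_on] closest_point_in_set)
  from measurable_compose[OF x_meas[OF order_refl, of k] borel_measurable_continuous_onI[OF this]]
  show ?thesis
    by (rule measurable_cong[THEN iffD1, rotated]) (simp add: closest_point_self x_in)
qed

lemma w_meas: "w k \<in> borel_measurable M"
proof -
  have xk: "x k \<in> borel_measurable M" by (rule measurable_from_subalg[OF subalgebra_filtration x_meas[OF order_refl]])
  have "(\<lambda>\<omega>. Phi (x k \<omega>) (xi k \<omega>)) \<in> borel_measurable M"
    using measurable_compose[OF measurable_Pair[OF xk xi_meas] Phi_meas] by simp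
  then show ?thesis
    unfolding w_def using measurable_from_subalg[OF subalgebra_filtration F_x_meas] by (intro borel_measurable_diff)
qed

lemma w_second_moment: "(\<integral>\<^sup>+\<omega>. ennreal ((norm (w k \<omega>))\<^sup>2) \<partial>M) \<le> ennreal (nu\<^sup>2)"
  using w_meas by (intro nn_integral_le_of_nn_cond_exp_le[OF subalgebra_filtration _ w_var]) measurable

section \<open>Contraction and increment of one step\<close>

lemma Phi_eq: "Phi (x k \<omega>) (xi k \<omega>) = F (x k \<omega>) + w k \<omega>"
  by (simp add: w_def)

text \<open>The solution is fixed by the noiseless step with the same scaled stepsizes, so
  nonexpansiveness compares the two points before projection. Their difference has the form treated
  in \<open>scaled_step_bound\<close>, with \<open>u = x k \<omega> - z\<close> and
  \<open>v = F (x k \<omega>) - F z\<close>.\<close>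

lemma step_le:
  assumes sol: "is_VI_sol X F z" and \<omega>: "\<omega> \<in> space M"
  shows "(norm (x (Suc k) \<omega> - z))\<^sup>2 \<le> (1 - 2 * c * G k \<omega>) * (norm (x k \<omega> - z))\<^sup>2
    + (1 + \<beta>)\<^sup>2 * (G k \<omega>)\<^sup>2 * (norm (w k \<omega>))\<^sup>2
    + G k \<omega> * ((\<chi> j. - 2 * r (blk j) * ((x k \<omega> - z) $ j - G k \<omega> * r (blk j) * (F (x k \<omega>) - F z) $ j)) \<bullet> w k \<omega>)"
proof -
  let ?G = "G k \<omega>" and ?x = "x k \<omega>"
  have z: "z \<in> X" using sol by (simp add: is_VI_sol_def)
  have "closest_point X (z - (\<chi> j. r (blk j) * ?G * F z $ j)) = z"
  proof (rule VI_sol_closest_point[OF X_closed X_convex z])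
    fix y assume "y \<in> X"
    with sol show "0 \<le> (y - z) \<bullet> (\<chi> j. r (blk j) * ?G * F z $ j)"
      unfolding X_def using order_trans[OF zero_le_one r_ge] G_bounds(1)[OF \<omega>, of k]
      by (intro VI_sol_blockwise_scaled[where r = "\<lambda>i. r i * ?G"]) auto
  qed
  then have "norm (x (Suc k) \<omega> - z)
      \<le> norm ((?x - (\<chi> j. r (blk j) * ?G * Phi ?x (xi k \<omega>) $ j)) - (z - (\<chi> j. r (blk j) * ?G * F z $ j)))"
    using closest_point_lipschitz[OF X_convex X_closed X_ne,
        of "?x - (\<chi> j. r (blk j) * ?G * Phi ?x (xi k \<omega>) $ j)" "z - (\<chi> j. r (blk j) * ?G * F z $ j)"]
    by (simp add: x_Suc dist_norm)
  also have "(?x - (\<chi> j. r (blk j) * ?G * Phi ?x (xi k \<omega>) $ j)) - (z - (\<chi> j. r (blk j) * ?G * F z $ j))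
      = (?x - z) - ?G *\<^sub>R (\<chi> j. r (blk j) * ((F ?x - F z) + w k \<omega>) $ j)"
    unfolding Phi_eq by (auto simp: vec_eq_iff algebra_simps)
  finally have "(norm (x (Suc k) \<omega> - z))\<^sup>2
      \<le> (norm ((?x - z) - ?G *\<^sub>R (\<chi> j. r (blk j) * ((F ?x - F z) + w k \<omega>) $ j)))\<^sup>2"
    by (intro power_mono) auto
  also note scaled_step_bound[where r = "\<lambda>j. r (blk j)", OF lipschitz[OF x_in[OF \<omega>, of k] z]
      strongly_monotone[OF x_in[OF \<omega>, of k] z] r_ge r_le less_imp_le[OF G_bounds(1)[OF \<omega>, of k]]
      G_bounds(2)[OF \<omega>, of k], of "w k \<omega>"]
  also have "eta - \<beta> * L = 2 * c" using L_pos by (simp add: \<beta>_def)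
  finally show ?thesis .
qed

text \<open>The iterate lies in \<open>X\<close> and is its own projection, so a step moves it no
  farther than the unprojected displacement.\<close>

lemma norm_increment_le:
  assumes "\<omega> \<in> space M"
  shows "norm (x (Suc k) \<omega> - x k \<omega>) \<le> (1 + \<beta>) * G k \<omega> * norm (F (x k \<omega>) + w k \<omega>)"
proof -
  let ?s = "\<chi> j. r (blk j) * G k \<omega> * (F (x k \<omega>) + w k \<omega>) $ j"
  have "norm (x (Suc k) \<omega> - x k \<omega>) \<le> norm ?s"
    using closest_point_lipschitz[OF X_convex X_closed X_ne, of "x k \<omega> - ?s" "x k \<omega>"]
    by (simp add: x_Suc Phi_eq dist_norm closest_point_self x_in assms)
  also have "\<dots> \<le> (1 + \<beta>) * G k \<omega> * norm (F (x k \<omega>) + w k \<omega>)"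
  proof (rule norm_scaled_le)
    fix j
    have "0 \<le> r (blk j) * G k \<omega>" using r_ge[of "blk j"] G_bounds(1)[OF assms, of k] by simp
    then show "\<bar>r (blk j) * G k \<omega>\<bar> \<le> (1 + \<beta>) * G k \<omega>"
      using r_le[of "blk j"] G_bounds(1)[OF assms, of k] by simp
  qed
  finally show ?thesis .
qed

lemma AE_tendsto_VI_sol:
  assumes sol: "is_VI_sol X F z"
  shows "AE \<omega> in M. (\<lambda>k. x k \<omega>) \<longlonglongrightarrow> z"
proof -
  have z: "z \<in> X" using sol by (simp add: is_VI_sol_def)
  define R where "R = diamD X z"
  have R: "norm (x k \<omega> - z) \<le> R" if "\<omega> \<in> space M" for k \<omega>
    unfolding R_def using x_in[OF that] by (rule norm_le_diamD[OF X_bounded])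
  obtain d where d: "0 < d" "\<And>\<omega>. \<omega> \<in> space M \<Longrightarrow> d \<le> D \<omega>" using diam_lower_bound by blast
  \<comment> \<open>The initial stepsize factor evaluated at the deterministic lower bound
    \<open>d\<close> of the diameter.\<close>
  define g where "g = c * d\<^sup>2 / ((1 + \<beta>)\<^sup>2 * nu\<^sup>2)"
  have g: "0 < g" using d c_pos nu_pos beta_nonneg by (auto simp: g_def intro!: divide_pos_pos mult_pos_pos)
  have g_le: "g \<le> c * (D \<omega>)\<^sup>2 / ((1 + \<beta>)\<^sup>2 * nu\<^sup>2)" if "\<omega> \<in> space M" for \<omega>
    unfolding g_def using d(1) d(2)[OF that] c_pos by (intro divide_right_mono mult_left_mono power_mono) auto
  have xM [measurable]: "x k \<in> borel_measurable M" for k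
    by (rule measurable_from_subalg[OF subalgebra_filtration x_meas[OF order_refl]])
  note [measurable] = w_meas
  define Y where "Y k \<omega> = (\<chi> j. - 2 * r (blk j) * ((x k \<omega> - z) $ j - G k \<omega> * r (blk j) * (F (x k \<omega>) - F z) $ j))" for k \<omega>
  have YA: "Y k \<in> borel_measurable (A k)" for k
    unfolding Y_def using x_meas[OF order_refl, of k] G_meas[of k k] F_x_meas[of k]
    by (intro borel_measurable_vec_lambda borel_measurable_diff borel_measurable_times
        borel_measurable_const borel_measurable_vec_component)
  \<comment> \<open>From \<open>norm (x k \<omega> - z) \<le> R\<close>, the Lipschitz bound
    \<open>L * R\<close> for the drift, \<open>G k \<omega> \<le> 1 / c\<close> and
    \<open>r i \<le> 1 + \<beta>\<close>.\<close>
  define K where "K = 2 * (1 + \<beta>) * (R + 1 / c * (1 + \<beta>) * (L * R))"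
  have Yb: "norm (Y k \<omega>) \<le> K" if \<omega>: "\<omega> \<in> space M" for k \<omega>
  proof -
    define v where "v = F (x k \<omega>) - F z"
    have v: "norm v \<le> L * R"
      unfolding v_def using lipschitz[OF x_in[OF \<omega>] z] R[OF \<omega>] L_pos
      by (meson mult_left_mono less_imp_le order_trans)
    have Gc: "G k \<omega> \<le> 1 / c"
    proof -
      have "c * G k \<omega> \<le> 1" using G_bounds(3)[OF \<omega>, of k] by (rule order_trans) simp
      then show ?thesis using c_pos by (simp add: field_simps)
    qed
    have "norm (Y k \<omega>) \<le> 2 * (1 + \<beta>) * norm (x k \<omega> - z - (\<chi> j. G k \<omega> * r (blk j) * v $ j))"
    proof -
      have "Y k \<omega> = (\<chi> j. (- 2 * r (blk j)) * (x k \<omega> - z - (\<chi> j. G k \<omega> * r (blk j) * v $ j)) $ j)"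
        by (simp add: Y_def v_def)
      moreover have "\<bar>- 2 * r (blk j)\<bar> \<le> 2 * (1 + \<beta>)" for j
        using r_ge[of "blk j"] r_le[of "blk j"] by simp
      ultimately show ?thesis by (simp only: norm_scaled_le)
    qed
    also have "norm (x k \<omega> - z - (\<chi> j. G k \<omega> * r (blk j) * v $ j)) \<le> R + 1 / c * (1 + \<beta>) * norm v"
    proof (rule order_trans[OF norm_triangle_ineq4], intro add_mono R[OF \<omega>] norm_scaled_le)
      fix j
      have "\<bar>G k \<omega> * r (blk j)\<bar> = G k \<omega> * r (blk j)"
        using r_ge[of "blk j"] G_bounds(1)[OF \<omega>, of k] by simp
      also have "\<dots> \<le> 1 / c * (1 + \<beta>)"
        using Gc r_le r_ge[of "blk j"] G_bounds(1)[OF \<omega>, of k] c_pos by (intro mult_mono) auto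
      finally show "\<bar>G k \<omega> * r (blk j)\<bar> \<le> 1 / c * (1 + \<beta>)" .
    qed
    also have "R + 1 / c * (1 + \<beta>) * norm v \<le> R + 1 / c * (1 + \<beta>) * (L * R)"
      using v c_pos beta_nonneg by (intro add_left_mono mult_left_mono) auto
    finally show ?thesis using beta_nonneg by (simp add: K_def mult_left_mono)
  qed
  \<comment> \<open>The constant of \<open>mean_square_rate_rec_seq\<close> with
    \<open>B = R\<^sup>2\<close> and \<open>b = (1 + \<beta>)\<^sup>2\<close>.\<close>
  define C1 where "C1 = (R\<^sup>2 / g\<^sup>2 + 4 * (1 + \<beta>)\<^sup>2 * nu\<^sup>2) / c\<^sup>2"
  have C1: "(\<integral>\<^sup>+\<omega>. ennreal ((norm (x k \<omega> - z))\<^sup>2) \<partial>M) \<le> ennreal (C1 / (real k + 1))" for k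
    unfolding C1_def
  proof (rule mean_square_rate_rec_seq[where A = A and w = w and Y = Y and K = K
        and ?G0.0 = "\<lambda>\<omega>. c * (D \<omega>)\<^sup>2 / ((1 + \<beta>)\<^sup>2 * nu\<^sup>2)"])
    show "(\<lambda>\<omega>. c * (D \<omega>)\<^sup>2 / ((1 + \<beta>)\<^sup>2 * nu\<^sup>2)) \<in> borel_measurable (A k)" for k
      using G_meas[of 0 k] by (simp add: G_def)
    show "c * (c * (D \<omega>)\<^sup>2 / ((1 + \<beta>)\<^sup>2 * nu\<^sup>2)) \<le> 1 / 2" if "\<omega> \<in> space M" for \<omega>
      using G_bounds(4)[OF that] by (simp add: G_def)
    show "(norm (x k \<omega> - z))\<^sup>2 \<le> R\<^sup>2" if "\<omega> \<in> space M" for k \<omega>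
      using R[OF that] by (intro power_mono) auto
  qed (use subalgebra_filtration c_pos g g_le YA Yb w_int w_mean_zero w_meas w_second_moment step_le[OF sol] in
      \<open>auto simp: Y_def G_def\<close>)
  \<comment> \<open>\<open>Q\<close> bounds \<open>F\<close> along the iterates. In
    \<open>C2\<close> the factor 2 comes from
    \<open>(s + t)\<^sup>2 \<le> 2 * (s\<^sup>2 + t\<^sup>2)\<close>, and \<open>1 / c\<close> from
    \<open>G k \<omega> \<le> 1 / c / (k + 1)\<close>.\<close>
  define Q where "Q = norm (F z) + L * R"
  define C2 where "C2 = ((1 + \<beta>) / c)\<^sup>2 * 2 * (Q\<^sup>2 + nu\<^sup>2)"
  have C2: "(\<integral>\<^sup>+\<omega>. ennreal ((norm (x (Suc k) \<omega> - x k \<omega>))\<^sup>2) \<partial>M) \<le> ennreal (C2 / (real k + 1)\<^sup>2)" for k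
  proof -
    define p where "p = ((1 + \<beta>) / c / (real k + 1))\<^sup>2 * 2"
    have p: "0 \<le> p" by (simp add: p_def)
    have "(norm (x (Suc k) \<omega> - x k \<omega>))\<^sup>2 \<le> p * (Q\<^sup>2 + (norm (w k \<omega>))\<^sup>2)" if \<omega>: "\<omega> \<in> space M" for \<omega>
    proof -
      have "norm (F (x k \<omega>)) \<le> norm (F z) + norm (F (x k \<omega>) - F z)"
        using norm_triangle_ineq[of "F z" "F (x k \<omega>) - F z"] by simp
      also have "norm (F (x k \<omega>) - F z) \<le> L * R"
        using lipschitz[OF x_in[OF \<omega>] z] R[OF \<omega>] L_pos by (meson mult_left_mono less_imp_le order_trans)
      finally have Fx: "norm (F (x k \<omega>)) \<le> Q" by (simp add: Q_def)
      have "norm (F (x k \<omega>) + w k \<omega>) \<le> Q + norm (w k \<omega>)"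
        using norm_triangle_ineq[of "F (x k \<omega>)" "w k \<omega>"] Fx by linarith
      then have "(norm (F (x k \<omega>) + w k \<omega>))\<^sup>2 \<le> (Q + norm (w k \<omega>))\<^sup>2" by (intro power_mono) auto
      also have "\<dots> \<le> 2 * (Q\<^sup>2 + (norm (w k \<omega>))\<^sup>2)"
        using zero_le_power2[of "Q - norm (w k \<omega>)"] by (simp add: power2_eq_square algebra_simps)
      finally have Fw: "(norm (F (x k \<omega>) + w k \<omega>))\<^sup>2 \<le> 2 * (Q\<^sup>2 + (norm (w k \<omega>))\<^sup>2)" .
      have "G k \<omega> \<le> 1 / c / (real k + 1)"
        using divide_right_mono[OF G_bounds(3)[OF \<omega>, of k], of c] c_pos by (simp add: mult.commute)
      then have "(1 + \<beta>) * G k \<omega> \<le> (1 + \<beta>) * (1 / c / (real k + 1))"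
        using beta_nonneg by (intro mult_left_mono) auto
      then have GG: "((1 + \<beta>) * G k \<omega>)\<^sup>2 \<le> ((1 + \<beta>) / c / (real k + 1))\<^sup>2"
        using beta_nonneg G_bounds(1)[OF \<omega>, of k] by (intro power_mono) auto
      have "(norm (x (Suc k) \<omega> - x k \<omega>))\<^sup>2 \<le> ((1 + \<beta>) * G k \<omega> * norm (F (x k \<omega>) + w k \<omega>))\<^sup>2"
        using norm_increment_le[OF \<omega>] by (intro power_mono) auto
      also have "\<dots> = ((1 + \<beta>) * G k \<omega>)\<^sup>2 * (norm (F (x k \<omega>) + w k \<omega>))\<^sup>2" by (simp add: power_mult_distrib)
      also have "\<dots> \<le> ((1 + \<beta>) / c / (real k + 1))\<^sup>2 * (2 * (Q\<^sup>2 + (norm (w k \<omega>))\<^sup>2))"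
        using GG Fw by (intro mult_mono) auto
      finally show ?thesis by (simp add: p_def mult.assoc)
    qed
    then have "(\<integral>\<^sup>+\<omega>. ennreal ((norm (x (Suc k) \<omega> - x k \<omega>))\<^sup>2) \<partial>M)
      \<le> (\<integral>\<^sup>+\<omega>. ennreal p * (ennreal (Q\<^sup>2) + ennreal ((norm (w k \<omega>))\<^sup>2)) \<partial>M)"
      using p by (intro nn_integral_mono)
        (simp add: ennreal_mult[symmetric] ennreal_plus[symmetric] ennreal_leI del: ennreal_plus)
    also have "\<dots> = ennreal p * (ennreal (Q\<^sup>2) + (\<integral>\<^sup>+\<omega>. ennreal ((norm (w k \<omega>))\<^sup>2) \<partial>M))"
      by (simp add: nn_integral_cmult nn_integral_add emeasure_space_1)
    also have "\<dots> \<le> ennreal p * (ennreal (Q\<^sup>2) + ennreal (nu\<^sup>2))"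
      by (intro mult_left_mono add_left_mono w_second_moment) auto
    also have "\<dots> = ennreal (p * (Q\<^sup>2 + nu\<^sup>2))"
      using p by (simp add: ennreal_mult)
    also have "p * (Q\<^sup>2 + nu\<^sup>2) = C2 / (real k + 1)\<^sup>2"
      by (simp add: p_def C2_def power_divide power_mult_distrib)
    finally show ?thesis .
  qed
  have nn: "0 \<le> C1" "0 \<le> C2" by (simp_all add: C1_def C2_def)
  show ?thesis
  proof (rule AE_tendsto_of_mean_square_rates[where C = "C1 + C2"])
    show "(\<integral>\<^sup>+\<omega>. ennreal ((norm (x k \<omega> - z))\<^sup>2) \<partial>M) \<le> ennreal ((C1 + C2) / (real k + 1))" for k
      using nn by (intro order_trans[OF C1] ennreal_leI divide_right_mono) auto
    show "(\<integral>\<^sup>+\<omega>. ennreal ((norm (x (Suc k) \<omega> - x k \<omega>))\<^sup>2) \<partial>M) \<le> ennreal ((C1 + C2) / (real k + 1)\<^sup>2)" for k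
      using nn by (intro order_trans[OF C2] ennreal_leI divide_right_mono) auto
  qed (use nn in auto)
qed

end

theorem theorem1:
  fixes M :: "'w measure" and S :: "'s measure"
    and blk :: "'n::finite \<Rightarrow> 'b::finite" and Xb :: "'b \<Rightarrow> (real^'n) set"
    and F :: "real^'n \<Rightarrow> real^'n" and Phi :: "real^'n \<Rightarrow> 's \<Rightarrow> real^'n"
    and xiF :: "'w \<Rightarrow> 's" and xi :: "nat \<Rightarrow> 'w \<Rightarrow> 's" and x0 :: "'w \<Rightarrow> real^'n"
    and L eta nu c :: real and r :: "'b \<Rightarrow> real"
  assumes M: "prob_space M"
    and blk_surj: "surj blk"
    and Xb_sub: "\<And>i. Xb i \<subseteq> blockspace blk i"
    and Xb_ne: "\<And>i. Xb i \<noteq> {}"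
    and Xb_closed: "\<And>i. closed (Xb i)"
    and Xb_convex: "\<And>i. convex (Xb i)"
    and X_bounded: "bounded (cartprod blk Xb)"
    and X_nontriv: "\<exists>x\<in>cartprod blk Xb. \<exists>y\<in>cartprod blk Xb. x \<noteq> y"
    and Phi_meas: "(\<lambda>p. Phi (fst p) (snd p)) \<in> borel_measurable (borel \<Otimes>\<^sub>M S)"
    and xiF_meas: "xiF \<in> measurable M S"
    and F_def: "\<And>x. x \<in> cartprod blk Xb \<Longrightarrow> F x = prob_space.expectation M (\<lambda>\<omega>. Phi x (xiF \<omega>))"
    and L_pos: "L > 0"
    and lipschitz: "\<And>x y. x \<in> cartprod blk Xb \<Longrightarrow> y \<in> cartprod blk Xb \<Longrightarrow>
                      norm (F x - F y) \<le> L * norm (x - y)"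
    and eta_pos: "eta > 0"
    and strongly_monotone: "\<And>x y. x \<in> cartprod blk Xb \<Longrightarrow> y \<in> cartprod blk Xb \<Longrightarrow>
                      (F x - F y) \<bullet> (x - y) \<ge> eta * (norm (x - y))^2"
    and x0_meas: "x0 \<in> borel_measurable M"
    and x0_in: "\<And>\<omega>. \<omega> \<in> space M \<Longrightarrow> x0 \<omega> \<in> cartprod blk Xb"
    and x0_sq_int: "integrable M (\<lambda>\<omega>. (norm (x0 \<omega>))^2)"
    and xi_meas: "\<And>k. xi k \<in> measurable M S"
    and x0_indep: "prob_space.indep_set M
        {x0 -` A \<inter> space M | A. A \<in> sets borel}
        {(\<lambda>\<omega> k. xi k \<omega>) -` B \<inter> space M | B. B \<in> sets (Pi\<^sub>M UNIV (\<lambda>_::nat. S))}"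
    and w_int: "\<And>k j. integrable M (\<lambda>\<omega>.
        (Phi (scheme_iter blk Xb F Phi xi x0 L eta nu c r \<omega> k) (xi k \<omega>)
         - F (scheme_iter blk Xb F Phi xi x0 L eta nu c r \<omega> k)) $ j)"
    and w_mean_zero: "\<And>k j. AE \<omega> in M. real_cond_exp M (nat_filtr M S x0 xi k) (\<lambda>\<omega>.
        (Phi (scheme_iter blk Xb F Phi xi x0 L eta nu c r \<omega> k) (xi k \<omega>)
         - F (scheme_iter blk Xb F Phi xi x0 L eta nu c r \<omega> k)) $ j) \<omega> = 0"
    and nu_pos: "nu > 0"
    and w_var: "\<And>k. AE \<omega> in M. nn_cond_exp M (nat_filtr M S x0 xi k) (\<lambda>\<omega>. ennreal ((norm
        (Phi (scheme_iter blk Xb F Phi xi x0 L eta nu c r \<omega> k) (xi k \<omega>)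
         - F (scheme_iter blk Xb F Phi xi x0 L eta nu c r \<omega> k)))^2)) \<omega> \<le> ennreal (nu^2)"
    and c_pos: "0 < c" and c_less: "c < eta / 2"
    and r_ge: "\<And>i. 1 \<le> r i" and r_le: "\<And>i. r i \<le> 1 + (eta - 2*c) / L"
    and nu_ge: "\<And>\<omega>. \<omega> \<in> space M \<Longrightarrow> nu \<ge> diamD (cartprod blk Xb) (x0 \<omega>) * L / sqrt 2"
  shows "(\<forall>\<omega>\<in>space M.
          let D = diamD (cartprod blk Xb) (x0 \<omega>);
              gam = (\<lambda>k i. stepsize L eta nu c (r i) D k);
              \<beta> = (eta - 2*c) / L;
              e0 = D^2;
              ds = rec_seq ((eta - \<beta>*L)/2) ((eta - \<beta>*L) / (2*(1+\<beta>)^2*nu^2) * e0);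
              Gs = rec_seq ((eta - \<beta>*L)/(2*(1+\<beta>))) ((eta - \<beta>*L) / (2*(1+\<beta>)*nu^2) * e0);
              e = err_fun (eta - \<beta>*L) ((1+\<beta>)^2*nu^2) e0;
              bnd = (eta - \<beta>*L) / ((1+\<beta>)^2 * L^2)
          in (\<forall>i j k. gam k i / r i = gam k j / r j)
           \<and> (\<forall>k. ds k \<le> Min (range (gam k)) \<and> Gs k \<ge> Max (range (gam k))
                  \<and> (Gs k - ds k) / ds k \<le> \<beta>)
           \<and> 0 \<le> \<beta> \<and> \<beta> < eta / L
           \<and> (\<forall>k. e ds k = 2*(1+\<beta>)^2*nu^2 / (eta - \<beta>*L) * ds k)
           \<and> (\<forall>k\<ge>1. \<forall>d. (\<forall>j<k. 0 < d j \<and> d j \<le> bnd) \<longrightarrow>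
                 (\<forall>j<k. 0 < ds j \<and> ds j \<le> bnd)
               \<and> e d k - e ds k \<ge> (1+\<beta>)^2*nu^2*(d (k-1) - ds (k-1))^2
               \<and> e ds k \<le> e d k))
      \<and> (\<exists>xs. is_VI_sol (cartprod blk Xb) F xs
            \<and> (\<forall>y. is_VI_sol (cartprod blk Xb) F y \<longrightarrow> y = xs)
            \<and> (AE \<omega> in M. (scheme_iter blk Xb F Phi xi x0 L eta nu c r \<omega>) \<longlonglongrightarrow> xs))"
proof -
  interpret cartesian_svi M S blk Xb F Phi xi x0 L eta nu c r "cartprod blk Xb"
    "\<lambda>k \<omega>. scheme_iter blk Xb F Phi xi x0 L eta nu c r \<omega> k"
    "\<lambda>k \<omega>. Phi (scheme_iter blk Xb F Phi xi x0 L eta nu c r \<omega> k) (xi k \<omega>)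
       - F (scheme_iter blk Xb F Phi xi x0 L eta nu c r \<omega> k)"
    "(eta - 2 * c) / L" "\<lambda>\<omega>. diamD (cartprod blk Xb) (x0 \<omega>)"
    "\<lambda>k \<omega>. rec_seq c (c * (diamD (cartprod blk Xb) (x0 \<omega>))\<^sup>2 / ((1 + (eta - 2 * c) / L)\<^sup>2 * nu\<^sup>2)) k"
    by (intro cartesian_svi.intro cartesian_svi_axioms.intro) fact+
  \<comment> \<open>A single deterministic solution serves for all realizations; the stepsize
    claims, by contrast, are proved separately for each realization with its own diameter.\<close>
  obtain z where z: "is_VI_sol (cartprod blk Xb) F z"
    using VI_sol_exists[OF X_closed X_convex X_ne L_pos eta_pos lipschitz strongly_monotone] by blast
  show ?thesis
  proof (intro conjI ballI exI[of _ z] allI impI)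
    fix \<omega> assume "\<omega> \<in> space M"
    note stepsize_bounds_and_optimality[OF L_pos eta_le_L c_pos c_less nu_pos D_pos[OF this] nu_ge[OF this] r_ge r_le]
    then show "let D = diamD (cartprod blk Xb) (x0 \<omega>);
              gam = (\<lambda>k i. stepsize L eta nu c (r i) D k);
              \<beta> = (eta - 2*c) / L;
              e0 = D^2;
              ds = rec_seq ((eta - \<beta>*L)/2) ((eta - \<beta>*L) / (2*(1+\<beta>)^2*nu^2) * e0);
              Gs = rec_seq ((eta - \<beta>*L)/(2*(1+\<beta>))) ((eta - \<beta>*L) / (2*(1+\<beta>)*nu^2) * e0);
              e = err_fun (eta - \<beta>*L) ((1+\<beta>)^2*nu^2) e0;
              bnd = (eta - \<beta>*L) / ((1+\<beta>)^2 * L^2)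
          in (\<forall>i j k. gam k i / r i = gam k j / r j)
           \<and> (\<forall>k. ds k \<le> Min (range (gam k)) \<and> Gs k \<ge> Max (range (gam k))
                  \<and> (Gs k - ds k) / ds k \<le> \<beta>)
           \<and> 0 \<le> \<beta> \<and> \<beta> < eta / L
           \<and> (\<forall>k. e ds k = 2*(1+\<beta>)^2*nu^2 / (eta - \<beta>*L) * ds k)
           \<and> (\<forall>k\<ge>1. \<forall>d. (\<forall>j<k. 0 < d j \<and> d j \<le> bnd) \<longrightarrow>
                 (\<forall>j<k. 0 < ds j \<and> ds j \<le> bnd)
               \<and> e d k - e ds k \<ge> (1+\<beta>)^2*nu^2*(d (k-1) - ds (k-1))^2
               \<and> e ds k \<le> e d k)"
      unfolding Let_def .
  next
    show "is_VI_sol (cartprod blk Xb) F z" by (rule z)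
  next
    fix y assume "is_VI_sol (cartprod blk Xb) F y"
    from VI_sol_unique[OF eta_pos strongly_monotone this z] show "y = z" .
  next
    show "AE \<omega> in M. (scheme_iter blk Xb F Phi xi x0 L eta nu c r \<omega>) \<longlonglongrightarrow> z"
      by (rule AE_tendsto_VI_sol[OF z])
  qed
qed

end
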